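(* Let $\mathscr{A}$ be an irreducible arrangement in an $\ell$-dimensional vector space $V$ over $\mathbb{K}$ and let $m:\mathscr{A}\to\mathbb{Z}_{\ge 0}$ be a multiplicity on $\mathscr{A}$. Assume that $\theta\in D(\mathscr{A},m+\mathbf{1})$ is homogeneous with $\deg\theta=d+1$. Then the following are equivalent: (1) $\theta$ is $m$-universal; (2) $(\mathscr{A},m)$ is free with $\exp(\mathscr{A},m)=(d,\ldots,d)$ and $(\mathscr{A},m+\mathbf{1})$ is $(d+1)$-critical.
   Context: $\mathbb{K}$ is a field of characteristic zero, $V$ an $\ell$-dimensional $\mathbb{K}$-vector space, $S=\mathbb{K}[x_1,\ldots,x_\ell]$ its coordinate ring, $\mathrm{Der}_S=\bigoplus_{i=1}^{\ell}S\,\partial_{x_i}$. A (central) arrangement $\mathscr{A}$ is a finite set of linear hyperplanes in $V$, assumed essential: $\bigcap_{H\in\mathscr{A}}H=\{0\}$. It is irreducible if it is not, after a linear change of coordinates, a product of two arrangements in nonzero spaces $V_1,V_2$ with $V=V_1\oplus V_2$. For $H\in\mathscr{A}$ fix $\alpha_H\in V^*$ with $\ker\alpha_H=H$. A multiplicity is a map $m:\mathscr{A}\to\mathbb{Z}_{\ge 0}$; $\mathbf{1}$ is the multiplicity with constant value $1$, and $\delta_H$ is the multiplicity with value $1$ at $H$ and $0$ elsewhere. $D(\mathscr{A},m)=\{\theta\in\mathrm{Der}_S\mid\theta(\alpha_H)\in S\alpha_H^{m(H)}\ \forall H\in\mathscr{A}\}$. A nonzero derivation $\theta$ is homogeneous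 of degree $k$ if every nonzero $\theta(\alpha)$, $\alpha\in V^*$, is a homogeneous polynomial of degree $k$. $D(\mathscr{A},m)_k$ is the space of elements of degree $k$ (together with $0$), and $D(\mathscr{A},m)_{<k}$ the corresponding part in degrees less than $k$. $(\mathscr{A},m)$ is free if $D(\mathscr{A},m)$ is a free $S$-module; then $\exp(\mathscr{A},m)$ is the tuple of degrees (up to order) of a homogeneous basis. For $\varphi\in\mathrm{Der}_S$ and $\theta=\sum_i f_i\partial_{x_i}$ put $\nabla_\varphi\theta=\sum_i\varphi(f_i)\partial_{x_i}$. A homogeneous $\theta\in D(\mathscr{A},m+\mathbf{1})$ is $m$-universal if $\mathrm{Der}_S\to D(\mathscr{A},m)$, $\varphi\mapsto\nabla_\varphi\theta$, is an isomorphism of $S$-modules. $(\mathscr{A},m)$ is $k$-critical if $D(\mathscr{A},m)_k\ne(0)$, $D(\mathscr{A},m)_{<k}=(0)$, and $D(\mathscr{A},m+\delta_H)_k=(0)$ for every $H\in\mathscr{A}$. *)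

theory Defs
  imports "HOL-Library.Poly_Mapping" "HOL-Analysis.Cartesian_Space"
begin

text \<open>
  The vector space is \<open>V = 'k^'n\<close>, of dimension \<open>CARD('n)\<close>. Its coordinate ring \<open>S\<close> is the
  monoid algebra over \<open>'k\<close> of the monoid of exponent vectors \<open>'n \<Rightarrow>\<^sub>0 nat\<close>, with convolution
  product.
\<close>

type_synonym ('k, 'n) mpol = "('n \<Rightarrow>\<^sub>0 nat) \<Rightarrow>\<^sub>0 'k"

text \<open>
  The free module of derivations of \<open>S\<close> with basis the partial derivatives: the vector of
  coefficients \<open>f\<close> stands for the derivation \<open>\<Sum>i. f $ i * \<partial>\<^sub>i\<close>. The scalar
  multiplication by elements of \<open>S\<close> is \<open>(*s)\<close>.
\<close>

type_synonym ('k, 'n) der = "(('k, 'n) mpol)^'n"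

interpretation der: module "(*s) :: ('k::field_char_0, 'n::finite) mpol \<Rightarrow> ('k, 'n) der \<Rightarrow> ('k, 'n) der"
  by unfold_locales (vector algebra_simps)+

definition mvar :: "'n \<Rightarrow> ('k::field_char_0, 'n) mpol" where
  "mvar i = Poly_Mapping.single (Poly_Mapping.single i 1) 1"

definition mconst :: "'k::field_char_0 \<Rightarrow> ('k, 'n) mpol" where
  "mconst c = Poly_Mapping.single 0 c"

text \<open>
  The truncated subtraction of exponents is harmless: the coefficient vanishes when the
  exponent of the variable is \<open>0\<close>.
\<close>

definition pdiff :: "'n \<Rightarrow> ('k::field_char_0, 'n) mpol \<Rightarrow> ('k, 'n) mpol" where
  "pdiff i p = (\<Sum>t\<in>Poly_Mapping.keys p.
      Poly_Mapping.single (t - Poly_Mapping.single i 1)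
        (of_nat (Poly_Mapping.lookup t i) * Poly_Mapping.lookup p t))"

definition der_apply :: "('k::field_char_0, 'n::finite) der \<Rightarrow> ('k, 'n) mpol \<Rightarrow> ('k, 'n) mpol" where
  "der_apply \<theta> p = (\<Sum>i\<in>UNIV. \<theta> $ i * pdiff i p)"

definition nabla :: "('k::field_char_0, 'n::finite) der \<Rightarrow> ('k, 'n) der \<Rightarrow> ('k, 'n) der" where
  "nabla \<phi> \<theta> = (\<chi> i. der_apply \<phi> (\<theta> $ i))"

definition dual_space :: "(('k::field_char_0)^'n::finite \<Rightarrow> 'k) set" where
  "dual_space = {f. Vector_Spaces.linear (*s) (*) f}"

text \<open>The embedding of the dual space of \<open>V\<close> into \<open>S\<close>.\<close>

definition lin_poly :: "(('k::field_char_0)^'n::finite \<Rightarrow> 'k) \<Rightarrow> ('k, 'n) mpol" where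
  "lin_poly f = (\<Sum>i\<in>UNIV. mconst (f (axis i 1)) * mvar i)"

definition homogeneous_poly :: "nat \<Rightarrow> ('k::field_char_0, 'n::finite) mpol \<Rightarrow> bool" where
  "homogeneous_poly k p \<longleftrightarrow>
     (\<forall>t\<in>Poly_Mapping.keys p. (\<Sum>i\<in>UNIV. Poly_Mapping.lookup t i) = k)"

definition homogeneous_der :: "nat \<Rightarrow> ('k::field_char_0, 'n::finite) der \<Rightarrow> bool" where
  "homogeneous_der k \<theta> \<longleftrightarrow> \<theta> \<noteq> 0 \<and>
     (\<forall>f\<in>dual_space. der_apply \<theta> (lin_poly f) \<noteq> 0 \<longrightarrow>
        homogeneous_poly k (der_apply \<theta> (lin_poly f)))"

definition hyperplane_in :: "('k::field_char_0^'n::finite) set \<Rightarrow> ('k^'n) set \<Rightarrow> bool" where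
  "hyperplane_in W H \<longleftrightarrow> vec.subspace H \<and> H \<subseteq> W \<and> vec.dim H + 1 = vec.dim W"

definition arrangement_in :: "('k::field_char_0^'n::finite) set \<Rightarrow> ('k^'n) set set \<Rightarrow> bool" where
  "arrangement_in W A \<longleftrightarrow> finite A \<and> (\<forall>H\<in>A. hyperplane_in W H)"

definition arrangement :: "('k::field_char_0^'n::finite) set set \<Rightarrow> bool" where
  "arrangement A \<longleftrightarrow> arrangement_in UNIV A \<and> \<Inter>A = {0}"

definition subspace_sum :: "('k::field_char_0^'n::finite) set \<Rightarrow> ('k^'n) set \<Rightarrow> ('k^'n) set" where
  "subspace_sum U W = {u + w | u w. u \<in> U \<and> w \<in> W}"

text \<open>
  A product decomposition with respect to an internal direct sum \<open>V = V1 \<oplus> V2\<close>; as the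
  summands are arbitrary, this accounts for the linear changes of coordinates.
  The factors of an essential arrangement are automatically essential.
\<close>

definition irreducible_arrangement :: "('k::field_char_0^'n::finite) set set \<Rightarrow> bool" where
  "irreducible_arrangement A \<longleftrightarrow>
     \<not> (\<exists>V1 V2 A1 A2. vec.subspace V1 \<and> vec.subspace V2 \<and> V1 \<noteq> {0} \<and> V2 \<noteq> {0} \<and>
          V1 \<inter> V2 = {0} \<and> subspace_sum V1 V2 = UNIV \<and>
          arrangement_in V1 A1 \<and> arrangement_in V2 A2 \<and>
          A = {subspace_sum H V2 | H. H \<in> A1} \<union> {subspace_sum V1 H | H. H \<in> A2})"

definition defining_forms ::
  "('k::field_char_0^'n::finite) set set \<Rightarrow> (('k^'n) set \<Rightarrow> 'k^'n \<Rightarrow> 'k) \<Rightarrow> bool" where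
  "defining_forms A \<alpha> \<longleftrightarrow> (\<forall>H\<in>A. \<alpha> H \<in> dual_space \<and> {v. \<alpha> H v = 0} = H)"

text \<open>
  In the following definitions \<open>\<alpha>\<close> is the chosen family of defining forms of the arrangement.
  A multiplicity is a function on all subsets of \<open>V\<close>, only its values on \<open>A\<close> matter.
\<close>

definition log_der ::
  "('k::field_char_0^'n::finite) set set \<Rightarrow> (('k^'n) set \<Rightarrow> 'k^'n \<Rightarrow> 'k) \<Rightarrow>
    (('k^'n) set \<Rightarrow> nat) \<Rightarrow> ('k, 'n) der set" where
  "log_der A \<alpha> m = {\<theta>. \<forall>H\<in>A. lin_poly (\<alpha> H) ^ m H dvd der_apply \<theta> (lin_poly (\<alpha> H))}"

definition log_der_deg ::
  "('k::field_char_0^'n::finite) set set \<Rightarrow> (('k^'n) set \<Rightarrow> 'k^'n \<Rightarrow> 'k) \<Rightarrow>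
    (('k^'n) set \<Rightarrow> nat) \<Rightarrow> nat \<Rightarrow> ('k, 'n) der set" where
  "log_der_deg A \<alpha> m k = {\<theta> \<in> log_der A \<alpha> m. \<theta> = 0 \<or> homogeneous_der k \<theta>}"

definition log_der_below ::
  "('k::field_char_0^'n::finite) set set \<Rightarrow> (('k^'n) set \<Rightarrow> 'k^'n \<Rightarrow> 'k) \<Rightarrow>
    (('k^'n) set \<Rightarrow> nat) \<Rightarrow> nat \<Rightarrow> ('k, 'n) der set" where
  "log_der_below A \<alpha> m k = {\<Sum>j<k. \<eta> j | \<eta>. \<forall>j<k. \<eta> j \<in> log_der_deg A \<alpha> m j}"

definition der_basis :: "('k::field_char_0, 'n::finite) der set \<Rightarrow> ('k, 'n) der set \<Rightarrow> bool" where
  "der_basis M B \<longleftrightarrow> der.independent B \<and> der.span B = M"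

definition free_mult ::
  "('k::field_char_0^'n::finite) set set \<Rightarrow> (('k^'n) set \<Rightarrow> 'k^'n \<Rightarrow> 'k) \<Rightarrow>
    (('k^'n) set \<Rightarrow> nat) \<Rightarrow> bool" where
  "free_mult A \<alpha> m \<longleftrightarrow> (\<exists>B. der_basis (log_der A \<alpha> m) B)"

text \<open>
  The tuple of exponents is unique only up to order, hence a relation: \<open>es\<close> lists the degrees
  of the members of a homogeneous basis, in some order.
\<close>

definition has_exponents ::
  "('k::field_char_0^'n::finite) set set \<Rightarrow> (('k^'n) set \<Rightarrow> 'k^'n \<Rightarrow> 'k) \<Rightarrow>
    (('k^'n) set \<Rightarrow> nat) \<Rightarrow> nat list \<Rightarrow> bool" where
  "has_exponents A \<alpha> m es \<longleftrightarrow>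
     (\<exists>bs. distinct bs \<and> der_basis (log_der A \<alpha> m) (set bs) \<and> list_all2 homogeneous_der es bs)"

definition mult_plus_one :: "('v set \<Rightarrow> nat) \<Rightarrow> 'v set \<Rightarrow> nat" where
  "mult_plus_one m = (\<lambda>H. m H + 1)"

definition mult_plus_delta :: "('v set \<Rightarrow> nat) \<Rightarrow> 'v set \<Rightarrow> 'v set \<Rightarrow> nat" where
  "mult_plus_delta m H = (\<lambda>H'. m H' + (if H' = H then 1 else 0))"

definition universal_der ::
  "('k::field_char_0^'n::finite) set set \<Rightarrow> (('k^'n) set \<Rightarrow> 'k^'n \<Rightarrow> 'k) \<Rightarrow>
    (('k^'n) set \<Rightarrow> nat) \<Rightarrow> ('k, 'n) der \<Rightarrow> bool" where
  "universal_der A \<alpha> m \<theta> \<longleftrightarrow>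
     \<theta> \<in> log_der A \<alpha> (mult_plus_one m) \<and> (\<exists>k. homogeneous_der k \<theta>) \<and>
     module_hom (*s) (*s) (\<lambda>\<phi>. nabla \<phi> \<theta>) \<and>
     bij_betw (\<lambda>\<phi>. nabla \<phi> \<theta>) UNIV (log_der A \<alpha> m)"

definition critical ::
  "('k::field_char_0^'n::finite) set set \<Rightarrow> (('k^'n) set \<Rightarrow> 'k^'n \<Rightarrow> 'k) \<Rightarrow>
    (('k^'n) set \<Rightarrow> nat) \<Rightarrow> nat \<Rightarrow> bool" where
  "critical A \<alpha> m k \<longleftrightarrow>
     log_der_deg A \<alpha> m k \<noteq> {0} \<and> log_der_below A \<alpha> m k = {0} \<and>
     (\<forall>H\<in>A. log_der_deg A \<alpha> (mult_plus_delta m H) k = {0})"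

end

theory Submission
  imports Defs
begin

text \<open>
  Write \<open>L\<^sub>H\<close> for the linear form of a hyperplane \<open>H\<close>. If \<open>\<theta>(L\<^sub>H) = L\<^sub>H\<^sup>m\<^sup>+\<^sup>1 h\<close> for the value \<open>m\<close> of the
  multiplicity at \<open>H\<close> and \<open>v\<close> is a vector with \<open>\<alpha>\<^sub>H(v) \<noteq> 0\<close>, then
  \<open>\<partial>\<^sub>v \<theta>(L\<^sub>H) = (m + 1) \<alpha>\<^sub>H(v) L\<^sub>H\<^sup>m h + L\<^sub>H\<^sup>m\<^sup>+\<^sup>1 \<partial>\<^sub>v h\<close>. Thus \<open>L\<^sub>H\<^sup>m\<^sup>+\<^sup>1\<close> divides \<open>\<partial>\<^sub>v \<theta>(L\<^sub>H)\<close> only if \<open>\<theta>\<close>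
  has contact order one higher than required along \<open>H\<close>, that is, \<open>\<theta> \<in> D(A, m + 1 + \<delta>\<^sub>H)\<close>
  (\<open>log_der_delta_if_dvd_nabla\<close>). Both implications rest on this observation.

  From exponents and criticality to universality: if \<open>\<nabla>\<^sub>v \<theta> = 0\<close> for a constant vector \<open>v\<close>, the
  observation and criticality force \<open>\<alpha>\<^sub>H(v) = 0\<close> for all \<open>H\<close>, hence \<open>v = 0\<close>. Since all members of a
  homogeneous basis of \<open>D(A, m)\<close> have degree \<open>d\<close>, the \<open>\<nabla>\<^sub>\<partial>\<^sub>j \<theta>\<close>, also of degree \<open>d\<close>, are
  expressed in it by a constant square matrix, which is injective, hence invertible; so they form a
  basis too (\<open>exponents_critical_imp_universal\<close>).

  Conversely, if \<open>\<theta>\<close> is universal, the \<open>\<nabla>\<^sub>\<partial>\<^sub>j \<theta>\<close> form a basis of \<open>D(A, m)\<close> of degree \<open>d\<close>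
  (\<open>universal_imp_exponents\<close>), and \<open>D(A, m)\<close> vanishes below degree \<open>d\<close>. A homogeneous element \<open>\<eta>\<close> of
  \<open>D(A, m + 1)\<close> is determined by the \<open>\<nabla>\<^sub>v \<eta> \<in> D(A, m)\<close> through Euler's formula, so \<open>D(A, m + 1)\<close>
  vanishes up to degree \<open>d\<close>; constant derivations are excluded since \<open>A\<close> is essential. In degree
  \<open>d + 1\<close> one has \<open>\<nabla>\<^sub>v \<eta> = \<nabla>\<^sub>C\<^sub>v \<theta>\<close> for a linear map \<open>C\<close>. For \<open>v \<in> K\<close> the polynomial
  \<open>\<partial>\<^sub>v \<eta>(L\<^sub>K)\<close> is divisible by \<open>L\<^sub>K\<^sup>m\<^sup>+\<^sup>1\<close>, so \<open>C v \<in> K\<close> by the observation, because \<open>\<theta>\<close> lies in no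
  \<open>D(A, m + 1 + \<delta>\<^sub>K)\<close>: otherwise \<open>D(A, m)\<close>, the image of \<open>\<phi> \<mapsto> \<nabla>\<^sub>\<phi> \<theta>\<close>, would equal
  \<open>D(A, m + \<delta>\<^sub>K)\<close> (\<open>log_der_not_subset_delta\<close>). An endomorphism that preserves all
  hyperplanes of an irreducible arrangement is a scalar (\<open>irreducible_endomorphism_scalar\<close>), so
  \<open>\<eta> = c \<theta>\<close>, and \<open>\<eta> \<in> D(A, m + 1 + \<delta>\<^sub>H)\<close> only for \<open>c = 0\<close> (\<open>universal_imp_critical\<close>).

  Cancellation of linear forms, and the fact that a linear form which divides a product of
  pairwise non-proportional linear forms and a polynomial divides the polynomial, are both
  obtained by differentiating (\<open>lin_poly_mult_in_ideal\<close>).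
\<close>

section \<open>Partial derivatives of polynomials\<close>

lemma poly_mapping_sum_single:
  fixes p :: "'a \<Rightarrow>\<^sub>0 'b::comm_monoid_add"
  shows "(\<Sum>t\<in>Poly_Mapping.keys p. Poly_Mapping.single t (Poly_Mapping.lookup p t)) = p"
  by (rule poly_mapping_eqI)
    (auto simp: lookup_sum lookup_single when_def in_keys_iff sum.delta')

lemma poly_mapping_additive_induct [case_names zero single add]:
  fixes p :: "'a \<Rightarrow>\<^sub>0 'b::comm_monoid_add"
  assumes "P 0" "\<And>t c. P (Poly_Mapping.single t c)" "\<And>p q. P p \<Longrightarrow> P q \<Longrightarrow> P (p + q)"
  shows "P p"
proof -
  have "P (\<Sum>t\<in>X. Poly_Mapping.single t (Poly_Mapping.lookup p t))" if "finite X" for X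
    using that by (induction X rule: finite_induct) (auto intro: assms)
  from this[OF finite_keys[of p]] show ?thesis
    by (simp add: poly_mapping_sum_single)
qed

lemma lookup_pdiff:
  "Poly_Mapping.lookup (pdiff i p) s =
    of_nat (Poly_Mapping.lookup s i + 1) * Poly_Mapping.lookup p (s + Poly_Mapping.single i 1)"
proof -
  have *: "(of_nat (Poly_Mapping.lookup t i) * Poly_Mapping.lookup p t
        when t - Poly_Mapping.single i 1 = s) =
      (if t = s + Poly_Mapping.single i 1
       then of_nat (Poly_Mapping.lookup s i + 1) * Poly_Mapping.lookup p t else 0)" for t
  proof (cases "t = s + Poly_Mapping.single i 1")
    case True
    then show ?thesis by (simp add: lookup_add)
  next
    case False
    have "Poly_Mapping.lookup t i = 0" if "t - Poly_Mapping.single i 1 = s"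
    proof (rule ccontr)
      assume "Poly_Mapping.lookup t i \<noteq> 0"
      then have "t = s + Poly_Mapping.single i 1"
        unfolding that[symmetric]
        by (intro poly_mapping_eqI) (auto simp: lookup_add lookup_minus lookup_single when_def)
      with False show False by simp
    qed
    with False show ?thesis by (auto simp: when_def)
  qed
  show ?thesis
    unfolding pdiff_def lookup_sum lookup_single *
    by (simp add: in_keys_iff sum.delta del: of_nat_Suc of_nat_add)
qed

lemma pdiff_zero [simp]: "pdiff i 0 = 0"
  by (simp add: pdiff_def)

lemma pdiff_add: "pdiff i (p + q) = pdiff i p + pdiff i q"
  by (rule poly_mapping_eqI) (simp add: lookup_pdiff lookup_add algebra_simps)

lemma pdiff_sum: "pdiff i (sum f X) = (\<Sum>x\<in>X. pdiff i (f x))"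
  by (induction X rule: infinite_finite_induct) (auto simp: pdiff_add)

lemma pdiff_single:
  "pdiff i (Poly_Mapping.single t c) =
    Poly_Mapping.single (t - Poly_Mapping.single i 1) (of_nat (Poly_Mapping.lookup t i) * c)"
  by (cases "c = 0") (simp_all add: pdiff_def)

lemma pdiff_mult: "pdiff i (p * q) = pdiff i p * q + p * pdiff i q"
proof (induction p rule: poly_mapping_additive_induct)
  case (single s a)
  show ?case
  proof (induction q rule: poly_mapping_additive_induct)
    case (single t b)
    have shift: "u - Poly_Mapping.single i (Suc 0) + v = u + v - Poly_Mapping.single i (Suc 0)"
      if "Poly_Mapping.lookup u i \<noteq> 0" for u v :: "'a \<Rightarrow>\<^sub>0 nat"
      using that by (intro poly_mapping_eqI)
        (auto simp: lookup_add lookup_minus lookup_single when_def)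
    have shift': "v + (u - Poly_Mapping.single i (Suc 0)) = v + u - Poly_Mapping.single i (Suc 0)"
      if "Poly_Mapping.lookup u i \<noteq> 0" for u v :: "'a \<Rightarrow>\<^sub>0 nat"
      using shift[OF that, of v] by (simp add: add.commute)
    show ?case
      by (cases "Poly_Mapping.lookup s i = 0"; cases "Poly_Mapping.lookup t i = 0")
        (simp_all add: pdiff_single mult_single shift shift' lookup_add
          algebra_simps flip: single_add)
  qed (simp_all add: pdiff_add algebra_simps)
qed (simp_all add: pdiff_add algebra_simps)

lemma mconst_0 [simp]: "mconst 0 = 0"
  and mconst_1 [simp]: "mconst 1 = 1"
  and mconst_add: "mconst (a + b) = mconst a + mconst b"
  and mconst_mult: "mconst (a * b) = mconst a * mconst b"
  and mconst_of_nat: "mconst (of_nat n) = of_nat n"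
  by (simp_all add: mconst_def single_add mult_single)

lemma mconst_sum: "mconst (sum f X) = (\<Sum>x\<in>X. mconst (f x))"
  by (induction X rule: infinite_finite_induct) (auto simp: mconst_add)

lemma mconst_eq_iff [simp]: "mconst a = mconst b \<longleftrightarrow> a = b"
  unfolding mconst_def by (rule inj_eq[OF inj_single])

lemma mconst_eq_0_iff [simp]: "mconst a = 0 \<longleftrightarrow> a = 0"
  using mconst_eq_iff[of a 0] by (simp del: mconst_eq_iff)

lemma mconst_cancel:
  assumes "c \<noteq> 0"
  shows "mconst (inverse c) * (mconst c * p) = p"
  using assms by (simp flip: mult.assoc mconst_mult)

lemma mconst_dvd_cancel:
  fixes p :: "('k::field_char_0, 'n) mpol"
  assumes "c \<noteq> 0" and "q dvd mconst c * p"
  shows "q dvd p"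
  using dvd_mult[OF assms(2), of "mconst (inverse c)"] mconst_cancel[OF assms(1), of p] by simp

lemma pdiff_mconst [simp]: "pdiff i (mconst c) = 0"
  by (simp add: mconst_def pdiff_single)

lemma pdiff_mvar: "pdiff i (mvar j) = (if i = j then 1 else 0)"
  by (simp add: mvar_def pdiff_single lookup_single)

section \<open>Homogeneous components and Euler's formula\<close>

text \<open>The total degree of the monomial with exponent vector \<open>t\<close>.\<close>

definition mono_deg :: "('n::finite \<Rightarrow>\<^sub>0 nat) \<Rightarrow> nat" where
  "mono_deg t = (\<Sum>i\<in>UNIV. Poly_Mapping.lookup t i)"

text \<open>The homogeneous component of degree \<open>k\<close> of a polynomial.\<close>

definition hom_part :: "nat \<Rightarrow> ('k::field_char_0, 'n::finite) mpol \<Rightarrow> ('k, 'n) mpol" where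
  "hom_part k = Poly_Mapping.mapp (\<lambda>t c. c when mono_deg t = k)"

lemma mono_deg_0 [simp]: "mono_deg 0 = 0"
  and mono_deg_add: "mono_deg (s + t) = mono_deg s + mono_deg t"
  and mono_deg_single [simp]: "mono_deg (Poly_Mapping.single i n) = n"
  by (simp_all add: mono_deg_def lookup_add sum.distrib lookup_single when_def)

lemma mono_deg_eq_0_iff [simp]: "mono_deg t = 0 \<longleftrightarrow> t = 0"
  by (auto simp: mono_deg_def intro: poly_mapping_eqI)

lemma homogeneous_poly_iff:
  "homogeneous_poly k p \<longleftrightarrow> (\<forall>t. Poly_Mapping.lookup p t \<noteq> 0 \<longrightarrow> mono_deg t = k)"
  by (auto simp: homogeneous_poly_def mono_deg_def in_keys_iff)

lemma homogeneous_poly_0 [simp]: "homogeneous_poly k 0"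
  by (simp add: homogeneous_poly_iff)

lemma homogeneous_poly_single [simp]: "homogeneous_poly (mono_deg t) (Poly_Mapping.single t c)"
  by (auto simp: homogeneous_poly_iff lookup_single when_def)

lemma homogeneous_poly_mconst [simp]: "homogeneous_poly 0 (mconst c)"
  using homogeneous_poly_single[of 0 c] by (simp add: mconst_def)

lemma homogeneous_poly_add:
  "homogeneous_poly k p \<Longrightarrow> homogeneous_poly k q \<Longrightarrow> homogeneous_poly k (p + q)"
  by (auto simp: homogeneous_poly_iff lookup_add) (metis add.right_neutral)

lemma homogeneous_poly_sum:
  "(\<And>x. x \<in> X \<Longrightarrow> homogeneous_poly k (f x)) \<Longrightarrow> homogeneous_poly k (sum f X)"
  by (induction X rule: infinite_finite_induct) (auto intro: homogeneous_poly_add)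

lemma homogeneous_poly_mult:
  assumes "homogeneous_poly j p" "homogeneous_poly k q"
  shows "homogeneous_poly (j + k) (p * q)"
  unfolding homogeneous_poly_def
proof
  fix u assume "u \<in> Poly_Mapping.keys (p * q)"
  then obtain s t where "u = s + t" "s \<in> Poly_Mapping.keys p" "t \<in> Poly_Mapping.keys q"
    using keys_mult[of p q] by blast
  then show "(\<Sum>i\<in>UNIV. Poly_Mapping.lookup u i) = j + k"
    using assms by (simp add: homogeneous_poly_def lookup_add sum.distrib)
qed

lemma homogeneous_poly_mconst_mult:
  "homogeneous_poly k p \<Longrightarrow> homogeneous_poly k (mconst c * p)"
  using homogeneous_poly_mult[of 0 "mconst c" k p] by simp

lemma homogeneous_poly_pdiff:
  assumes "homogeneous_poly (k + 1) p"
  shows "homogeneous_poly k (pdiff i p)"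
  unfolding homogeneous_poly_iff
proof (intro allI impI)
  fix t assume "Poly_Mapping.lookup (pdiff i p) t \<noteq> 0"
  then have "Poly_Mapping.lookup p (t + Poly_Mapping.single i 1) \<noteq> 0"
    by (auto simp: lookup_pdiff)
  with assms have "mono_deg (t + Poly_Mapping.single i 1) = k + 1"
    by (auto simp: homogeneous_poly_iff)
  then show "mono_deg t = k"
    by (simp add: mono_deg_add)
qed

lemma euler:
  fixes p :: "('k::field_char_0, 'n::finite) mpol"
  assumes "homogeneous_poly k p"
  shows "(\<Sum>i\<in>UNIV. mvar i * pdiff i p) = of_nat k * p"
proof -
  have mono: "(\<Sum>i\<in>UNIV. mvar i * pdiff i (Poly_Mapping.single t c)) =
      of_nat (mono_deg t) * Poly_Mapping.single t c" for t :: "'n \<Rightarrow>\<^sub>0 nat" and c :: 'k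
  proof -
    have "mvar i * pdiff i (Poly_Mapping.single t c) =
        of_nat (Poly_Mapping.lookup t i) * Poly_Mapping.single t c" for i
    proof (cases "Poly_Mapping.lookup t i = 0")
      case False
      then have "Poly_Mapping.single i 1 + (t - Poly_Mapping.single i 1) = t"
        by (intro poly_mapping_eqI) (auto simp: lookup_add lookup_minus lookup_single when_def)
      then show ?thesis
        by (simp add: mvar_def pdiff_single mult_single flip: single_of_nat)
    qed (simp add: pdiff_single)
    then show ?thesis
      by (simp add: mono_deg_def sum_distrib_right)
  qed
  have expand: "pdiff i p = (\<Sum>t\<in>Poly_Mapping.keys p.
      pdiff i (Poly_Mapping.single t (Poly_Mapping.lookup p t)))" for i
    using arg_cong[OF poly_mapping_sum_single[of p], of "pdiff i"] by (simp add: pdiff_sum)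
  have "(\<Sum>i\<in>UNIV. mvar i * pdiff i p) =
      (\<Sum>t\<in>Poly_Mapping.keys p. \<Sum>i\<in>UNIV.
        mvar i * pdiff i (Poly_Mapping.single t (Poly_Mapping.lookup p t)))"
    by (subst sum.swap) (simp add: expand sum_distrib_left)
  also have "\<dots> = (\<Sum>t\<in>Poly_Mapping.keys p.
      of_nat k * Poly_Mapping.single t (Poly_Mapping.lookup p t))"
    using assms by (intro sum.cong) (auto simp: mono homogeneous_poly_iff in_keys_iff)
  also have "\<dots> = of_nat k * p"
    by (simp add: poly_mapping_sum_single flip: sum_distrib_left)
  finally show ?thesis .
qed

lemma lookup_hom_part:
  "Poly_Mapping.lookup (hom_part k p) t = (Poly_Mapping.lookup p t when mono_deg t = k)"
  by (auto simp: hom_part_def lookup_mapp when_def in_keys_iff)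

lemma hom_part_0 [simp]: "hom_part k 0 = 0"
  by (rule poly_mapping_eqI) (simp add: lookup_hom_part)

lemma hom_part_add: "hom_part k (p + q) = hom_part k p + hom_part k q"
  by (rule poly_mapping_eqI) (simp add: lookup_hom_part lookup_add when_def)

lemma hom_part_sum: "hom_part k (sum f X) = (\<Sum>x\<in>X. hom_part k (f x))"
  by (induction X rule: infinite_finite_induct) (auto simp: hom_part_add)

lemma hom_part_homogeneous:
  "homogeneous_poly j p \<Longrightarrow> hom_part k p = (if j = k then p else 0)"
  by (rule poly_mapping_eqI) (auto simp: lookup_hom_part homogeneous_poly_iff when_def)

lemma hom_part_mult_homogeneous:
  assumes "homogeneous_poly d q"
  shows "hom_part k (p * q) = (if d \<le> k then hom_part (k - d) p * q else 0)"
proof (induction p rule: poly_mapping_additive_induct)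
  case (single t c)
  show ?case
    using hom_part_homogeneous[OF homogeneous_poly_mult[OF homogeneous_poly_single assms], of k t c]
      hom_part_homogeneous[OF homogeneous_poly_single, of "k - d" t c]
    by (cases "d \<le> k"; cases "mono_deg t + d = k") auto
qed (auto simp: hom_part_add algebra_simps)

lemma hom_part_zero_const: "hom_part 0 p = mconst (Poly_Mapping.lookup p 0)"
  by (rule poly_mapping_eqI) (auto simp: lookup_hom_part mconst_def lookup_single when_def)

section \<open>Action of derivations on polynomials\<close>

lemma der_apply_add: "der_apply \<phi> (p + q) = der_apply \<phi> p + der_apply \<phi> q"
  by (simp add: der_apply_def pdiff_add algebra_simps sum.distrib)

lemma der_apply_0 [simp]: "der_apply \<phi> 0 = 0"
  by (simp add: der_apply_def)

lemma der_apply_mult: "der_apply \<phi> (p * q) = der_apply \<phi> p * q + p * der_apply \<phi> q"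
  by (simp add: der_apply_def pdiff_mult algebra_simps sum.distrib sum_distrib_left)

lemma der_apply_mconst [simp]: "der_apply \<phi> (mconst c) = 0"
  by (simp add: der_apply_def)

lemma der_apply_sum: "der_apply \<phi> (sum f X) = (\<Sum>x\<in>X. der_apply \<phi> (f x))"
  by (induction X rule: infinite_finite_induct) (auto simp: der_apply_add)

lemma der_apply_power:
  "der_apply \<phi> (p ^ Suc k) = of_nat (Suc k) * (p ^ k * der_apply \<phi> p)"
  by (induction k) (simp_all add: der_apply_mult algebra_simps)

lemma der_apply_add_left: "der_apply (\<phi> + \<psi>) p = der_apply \<phi> p + der_apply \<psi> p"
  by (simp add: der_apply_def algebra_simps sum.distrib)

lemma der_apply_scale_left: "der_apply (q *s \<phi>) p = q * der_apply \<phi> p"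
  by (simp add: der_apply_def algebra_simps sum_distrib_left)

lemma pdiff_lin_poly: "pdiff j (lin_poly f) = mconst (f (axis j 1))"
  by (simp add: lin_poly_def pdiff_sum pdiff_mult pdiff_mvar if_distrib[of "(*) _"] sum.delta
      cong: if_cong)

lemma der_apply_lin_poly: "der_apply \<theta> (lin_poly f) = (\<Sum>i\<in>UNIV. mconst (f (axis i 1)) * \<theta> $ i)"
  by (simp add: der_apply_def pdiff_lin_poly mult.commute)

lemma homogeneous_poly_lin_poly:
  fixes f :: "'k::field_char_0^'n::finite \<Rightarrow> 'k"
  shows "homogeneous_poly 1 (lin_poly f)"
  unfolding lin_poly_def
proof (intro homogeneous_poly_sum homogeneous_poly_mconst_mult)
  fix i :: 'n
  show "homogeneous_poly 1 (mvar i :: ('k, 'n) mpol)"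
    using homogeneous_poly_single[of "Poly_Mapping.single i 1" "1::'k"] by (simp add: mvar_def)
qed

lemma lin_poly_not_dvd_const:
  fixes f :: "'k::field_char_0^'n::finite \<Rightarrow> 'k"
  assumes "lin_poly f dvd mconst c"
  shows "c = 0"
proof -
  from assms obtain q where q: "mconst c = q * lin_poly f"
    by (auto simp: dvd_def mult.commute)
  have "(mconst c :: ('k, 'n) mpol) = hom_part 0 (mconst c)"
    by (simp add: hom_part_homogeneous[OF homogeneous_poly_mconst])
  also have "\<dots> = 0"
    unfolding q by (simp add: hom_part_mult_homogeneous[OF homogeneous_poly_lin_poly])
  finally show ?thesis by simp
qed

section \<open>Linear forms and directional derivatives\<close>

lemma dual_spaceD:
  assumes "f \<in> dual_space"
  shows "f (x + y) = f x + f y" "f (c *s x) = c * f x" "f 0 = 0" "f (x - y) = f x - f y"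
proof -
  from assms interpret f: Vector_Spaces.linear "(*s)" "(*)" f by (simp add: dual_space_def)
  show "f (x + y) = f x + f y" "f (c *s x) = c * f x" "f 0 = 0" "f (x - y) = f x - f y"
    by (rule f.add f.scale f.zero f.diff)+
qed

lemma dual_space_expand:
  assumes "f \<in> dual_space"
  shows "f v = (\<Sum>i\<in>UNIV. f (axis i 1) * v $ i)"
proof -
  from assms interpret f: Vector_Spaces.linear "(*s)" "(*)" f by (simp add: dual_space_def)
  have "f v = f (\<Sum>i\<in>UNIV. v $ i *s axis i 1)"
    by (simp add: basis_expansion)
  then show ?thesis
    by (simp add: f.sum f.scale mult.commute)
qed

lemma coordinate_in_dual_space: "(\<lambda>v. v $ i) \<in> dual_space"
  unfolding dual_space_def by (simp, unfold_locales) (simp_all add: algebra_simps)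

lemma lin_poly_coordinate: "der_apply \<theta> (lin_poly (\<lambda>v. v $ i)) = \<theta> $ i"
proof -
  have "der_apply \<theta> (lin_poly (\<lambda>v. v $ i)) = (\<Sum>j\<in>UNIV. if j = i then \<theta> $ j else 0)"
    unfolding der_apply_lin_poly by (intro sum.cong) (auto simp: axis_def)
  then show ?thesis by simp
qed

text \<open>
  The derivation with constant coefficients that differentiates in the direction of \<open>v\<close>.
\<close>

definition const_der :: "('k::field_char_0)^'n::finite \<Rightarrow> ('k, 'n) der" where
  "const_der v = (\<chi> i. mconst (v $ i))"

lemma const_der_nth [simp]: "const_der v $ i = mconst (v $ i)"
  by (simp add: const_der_def)

lemma const_der_scale: "const_der (c *s v) = mconst c *s const_der v"
  and const_der_add: "const_der (v + w) = const_der v + const_der w"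
  by (simp_all add: vec_eq_iff mconst_mult mconst_add)

lemma const_der_eq_iff [simp]: "const_der v = const_der w \<longleftrightarrow> v = w"
  by (simp add: vec_eq_iff)

lemma der_apply_const_der_lin_poly:
  assumes "f \<in> dual_space"
  shows "der_apply (const_der v) (lin_poly f) = mconst (f v)"
  by (subst dual_space_expand[OF assms]) (simp add: der_apply_lin_poly mconst_sum mconst_mult)

lemma lookup_mconst_mult: "Poly_Mapping.lookup (mconst c * p) t = c * Poly_Mapping.lookup p t"
proof (induction p rule: poly_mapping_additive_induct)
  case (single s a)
  show ?case by (simp add: mconst_def mult_single lookup_single when_def)
qed (simp_all add: lookup_add algebra_simps)

section \<open>Division by linear forms\<close>

text \<open>
  A linear form \<open>L\<close> is not a zero divisor modulo an ideal \<open>I\<close> that is closed under a directional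
  derivative \<open>D\<close> with \<open>D L \<noteq> 0\<close>. By induction on the degree of \<open>q\<close>, with \<open>a = D L\<close> constant,
  \<open>c a q + L D q \<in> I\<close> implies \<open>q \<in> I\<close> for every positive integer \<open>c\<close>: applying \<open>D\<close> turns the
  hypothesis into the same one for \<open>D q\<close> and \<open>c + 1\<close>, so \<open>D q \<in> I\<close> and hence \<open>c a q \<in> I\<close>. The
  case \<open>c = 1\<close> is the derivative of \<open>L q\<close>. With \<open>I = 0\<close> this is cancellation; with \<open>I\<close> generated
  by another linear form, killed by \<open>D\<close>, it is a primality property of that form.
\<close>

lemma lin_poly_mult_in_ideal:
  fixes I :: "('k::field_char_0, 'n::finite) mpol set" and p :: "('k, 'n) mpol"
  assumes diff: "\<And>p q. p \<in> I \<Longrightarrow> q \<in> I \<Longrightarrow> p - q \<in> I"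
    and mult: "\<And>p q. p \<in> I \<Longrightarrow> q * p \<in> I"
    and deriv: "\<And>p. p \<in> I \<Longrightarrow> der_apply (const_der u) p \<in> I"
    and f: "f \<in> dual_space" "f u \<noteq> 0"
    and p: "lin_poly f * p \<in> I"
  shows "p \<in> I"
proof -
  define D where "D = der_apply (const_der u)"
  define L where "L = lin_poly f"
  have DL: "D L = mconst (f u)"
    using f by (simp add: D_def L_def der_apply_const_der_lin_poly)
  have D_add: "D (p + q) = D p + D q" and D_mult: "D (p * q) = D p * q + p * D q"
    and D_const: "D (mconst c) = 0" for p q c
    by (simp_all add: D_def der_apply_add der_apply_mult)
  have D_deg: "mono_deg t < n"
    if q: "\<forall>t. Poly_Mapping.lookup q t \<noteq> 0 \<longrightarrow> mono_deg t < Suc n"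
      and t: "Poly_Mapping.lookup (D q) t \<noteq> 0" for q n t
  proof -
    have "(\<Sum>i\<in>UNIV. u $ i * Poly_Mapping.lookup (pdiff i q) t) \<noteq> 0"
      using t by (simp add: D_def der_apply_def lookup_sum lookup_mconst_mult)
    then obtain i where "Poly_Mapping.lookup (pdiff i q) t \<noteq> 0"
      by (metis (no_types, lifting) mult_zero_right sum.neutral)
    then have "Poly_Mapping.lookup q (t + Poly_Mapping.single i 1) \<noteq> 0"
      by (auto simp: lookup_pdiff)
    with q have "mono_deg (t + Poly_Mapping.single i 1) < Suc n" by blast
    then show ?thesis by (simp add: mono_deg_add)
  qed
  have claim: "q \<in> I"
    if "\<forall>t. Poly_Mapping.lookup q t \<noteq> 0 \<longrightarrow> mono_deg t < n"
      and "c \<noteq> 0" and "mconst (of_nat c * f u) * q + L * D q \<in> I" for q n c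
    using that
  proof (induction n arbitrary: q c)
    case 0
    then have "q = 0" by (intro poly_mapping_eqI) auto
    then show ?case using diff[OF p p] by simp
  next
    case (Suc n)
    have "D (mconst (of_nat c * f u) * q + L * D q) \<in> I"
      using deriv[OF Suc.prems(3)] by (simp add: D_def)
    also have "D (mconst (of_nat c * f u) * q + L * D q) =
        mconst (of_nat (Suc c) * f u) * D q + L * D (D q)"
      by (simp add: D_add D_mult D_const DL mconst_add mconst_mult algebra_simps)
    finally have "D q \<in> I"
      using D_deg[OF Suc.prems(1)] by (intro Suc.IH[of "D q" "Suc c"]) auto
    from diff[OF Suc.prems(3) mult[OF this, of L]]
    have "mconst (of_nat c * f u) * q \<in> I" by simp
    from mult[OF this, of "mconst (inverse (of_nat c * f u))"] show ?case
      using Suc.prems(2) f(2) mconst_cancel[of "of_nat c * f u" q] by simp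
  qed
  have "D (L * p) \<in> I"
    using deriv[OF p] by (simp add: D_def L_def)
  then have "mconst (of_nat 1 * f u) * p + L * D p \<in> I"
    by (simp add: D_mult DL)
  moreover have "mono_deg t < Suc (sum mono_deg (Poly_Mapping.keys p))"
    if "Poly_Mapping.lookup p t \<noteq> 0" for t
    using that member_le_sum[of t "Poly_Mapping.keys p" mono_deg] by (simp add: in_keys_iff)
  ultimately show ?thesis
    by (intro claim[of p "Suc (sum mono_deg (Poly_Mapping.keys p))" 1]) auto
qed

lemma lin_poly_mult_eq_0:
  assumes "f \<in> dual_space" "f u \<noteq> 0" "lin_poly f * p = 0"
  shows "p = 0"
proof -
  have "p \<in> {0}"
    by (rule lin_poly_mult_in_ideal[where u = u and f = f]) (use assms in simp_all)
  then show ?thesis by simp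
qed

lemma lin_poly_power_mult_cancel:
  assumes "f \<in> dual_space" "f u \<noteq> 0" "lin_poly f ^ k * p = lin_poly f ^ k * q"
  shows "p = q"
proof -
  have "lin_poly f ^ k * (p - q) = 0"
    using assms(3) by (simp add: algebra_simps)
  then have "p - q = 0"
  proof (induction k)
    case (Suc k)
    then show ?case
      using lin_poly_mult_eq_0[OF assms(1,2), of "lin_poly f ^ k * (p - q)"] by (simp add: mult.assoc)
  qed simp
  then show ?thesis by simp
qed

lemma lin_poly_power_Suc_dvd_cancel:
  assumes "f \<in> dual_space" "f u \<noteq> 0" "lin_poly f ^ Suc k dvd lin_poly f ^ k * p"
  shows "lin_poly f dvd p"
proof -
  from assms(3) obtain q where "lin_poly f ^ k * p = lin_poly f ^ Suc k * q"
    by (rule dvdE)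
  then have "lin_poly f ^ k * p = lin_poly f ^ k * (lin_poly f * q)"
    by (simp only: power_Suc2 mult.assoc)
  from lin_poly_power_mult_cancel[OF assms(1,2) this] show ?thesis by simp
qed

lemma lin_poly_dvd_lin_poly_mult:
  assumes f: "f \<in> dual_space" "f u = 0" and g: "g \<in> dual_space" "g u \<noteq> 0"
    and "lin_poly f dvd lin_poly g * p"
  shows "lin_poly f dvd p"
proof -
  have "p \<in> {p. lin_poly f dvd p}"
  proof (rule lin_poly_mult_in_ideal[where u = u and f = g])
    fix q assume "q \<in> {p. lin_poly f dvd p}"
    then obtain r where "q = lin_poly f * r" by auto
    then show "der_apply (const_der u) q \<in> {p. lin_poly f dvd p}"
      using f by (simp add: der_apply_mult der_apply_const_der_lin_poly)
  qed (use assms in auto)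
  then show ?thesis by simp
qed

lemma lin_poly_dvd_prod_mult:
  assumes "finite F" and "f \<in> dual_space"
    and "\<And>K. K \<in> F \<Longrightarrow> g K \<in> dual_space \<and> (\<exists>u. f u = 0 \<and> g K u \<noteq> 0)"
    and "lin_poly f dvd (\<Prod>K\<in>F. lin_poly (g K) ^ n K) * p"
  shows "lin_poly f dvd p"
  using assms(1,3,4)
proof (induction F rule: finite_induct)
  case (insert K F)
  have "g K \<in> dual_space \<and> (\<exists>u. f u = 0 \<and> g K u \<noteq> 0)"
    by (rule insert.prems(1)) simp
  then obtain u where u: "f u = 0" "g K u \<noteq> 0" "g K \<in> dual_space"
    by (elim conjE exE)
  have "lin_poly f dvd q" if "lin_poly f dvd lin_poly (g K) ^ j * q" for q j
    using that
  proof (induction j)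
    case (Suc j)
    from Suc.prems have "lin_poly f dvd lin_poly (g K) * (lin_poly (g K) ^ j * q)"
      by (simp only: power_Suc mult.assoc)
    then have "lin_poly f dvd lin_poly (g K) ^ j * q"
      by (rule lin_poly_dvd_lin_poly_mult[OF assms(2) u(1,3,2)])
    then show ?case by (rule Suc.IH)
  qed simp
  moreover have "lin_poly f dvd lin_poly (g K) ^ n K * ((\<Prod>K\<in>F. lin_poly (g K) ^ n K) * p)"
    using insert.prems(2) by (simp only: prod.insert[OF insert.hyps] mult.assoc)
  ultimately have "lin_poly f dvd (\<Prod>K\<in>F. lin_poly (g K) ^ n K) * p"
    by blast
  then show ?case
    by (rule insert.IH[rotated]) (rule insert.prems(1), rule insertI2)
qed simp

lemma lin_poly_dvd_if_dvd_derivative: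
  assumes f: "f \<in> dual_space" "f v \<noteq> 0"
    and dvd: "lin_poly f ^ Suc k dvd der_apply (const_der v) (lin_poly f ^ Suc k * h)"
  shows "lin_poly f dvd h"
proof -
  let ?L = "lin_poly f"
  have "der_apply (const_der v) (?L ^ Suc k * h) =
      ?L ^ k * (mconst (of_nat (Suc k) * f v) * h) + ?L ^ Suc k * der_apply (const_der v) h"
    using f by (simp add: der_apply_mult der_apply_power der_apply_const_der_lin_poly
        mconst_mult mconst_add mconst_of_nat algebra_simps del: power_Suc)
  with dvd have "?L ^ Suc k dvd ?L ^ k * (mconst (of_nat (Suc k) * f v) * h)"
    by (simp only: dvd_add_left_iff[OF dvd_triv_left])
  from lin_poly_power_Suc_dvd_cancel[OF f this] show ?thesis
    by (rule mconst_dvd_cancel[rotated]) (use f in \<open>simp del: of_nat_Suc\<close>)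
qed

section \<open>The operator \<open>nabla\<close>\<close>

lemma homogeneous_der_iff:
  "homogeneous_der k \<theta> \<longleftrightarrow> \<theta> \<noteq> 0 \<and> (\<forall>i. homogeneous_poly k (\<theta> $ i))"
proof
  assume *: "homogeneous_der k \<theta>"
  have "homogeneous_poly k (\<theta> $ i)" for i
    using * coordinate_in_dual_space[of i] lin_poly_coordinate[of \<theta> i]
    by (cases "\<theta> $ i = 0") (auto simp: homogeneous_der_def)
  with * show "\<theta> \<noteq> 0 \<and> (\<forall>i. homogeneous_poly k (\<theta> $ i))"
    by (simp add: homogeneous_der_def)
qed (auto simp: homogeneous_der_def der_apply_lin_poly
    intro!: homogeneous_poly_sum homogeneous_poly_mconst_mult)

lemma nabla_nth: "nabla \<phi> \<theta> $ i = der_apply \<phi> (\<theta> $ i)"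
  by (simp add: nabla_def)

lemma der_apply_nabla_lin_poly:
  "der_apply (nabla \<phi> \<theta>) (lin_poly f) = der_apply \<phi> (der_apply \<theta> (lin_poly f))"
  by (simp add: der_apply_lin_poly der_apply_sum der_apply_mult nabla_nth)

lemma nabla_add: "nabla (\<phi> + \<psi>) \<theta> = nabla \<phi> \<theta> + nabla \<psi> \<theta>"
  and nabla_scale: "nabla (q *s \<phi>) \<theta> = q *s nabla \<phi> \<theta>"
  by (simp_all add: vec_eq_iff nabla_nth der_apply_add_left der_apply_scale_left)

lemma module_hom_nabla: "module_hom (*s) (*s) (\<lambda>\<phi>. nabla \<phi> \<theta>)"
  by (simp add: module_hom_iff der.module_axioms nabla_add nabla_scale)

lemma nabla_zero [simp]: "nabla 0 \<theta> = 0"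
  using nabla_add[of 0 0 \<theta>] by simp

lemma nabla_diff: "nabla (\<phi> - \<psi>) \<theta> = nabla \<phi> \<theta> - nabla \<psi> \<theta>"
  using nabla_add[of "\<phi> - \<psi>" \<psi> \<theta>] by simp

lemma nabla_expand:
  fixes \<phi> :: "('k::field_char_0, 'n::finite) der"
  shows "nabla \<phi> \<theta> = (\<Sum>i\<in>UNIV. \<phi> $ i *s nabla (const_der (axis i 1)) \<theta>)"
proof -
  have "der_apply (const_der (axis i 1)) p = pdiff i p" for i :: 'n and p :: "('k, 'n) mpol"
  proof -
    have "der_apply (const_der (axis i 1)) p = (\<Sum>j\<in>UNIV. if j = i then pdiff j p else 0)"
      unfolding der_apply_def by (intro sum.cong) (auto simp: axis_def)
    then show ?thesis by simp
  qed
  then show ?thesis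
    by (simp add: vec_eq_iff nabla_nth der_apply_def)
qed

lemma homogeneous_nabla_const:
  assumes "\<And>i. homogeneous_poly (d + 1) (\<theta> $ i)"
  shows "homogeneous_poly d (nabla (const_der v) \<theta> $ i)"
  unfolding nabla_nth der_apply_def const_der_nth
  by (intro homogeneous_poly_sum homogeneous_poly_mconst_mult homogeneous_poly_pdiff assms)

text \<open>By Euler's formula, \<open>\<nabla>\<^sub>E \<theta> = k \<theta>\<close> for the Euler derivation \<open>E = \<Sum>\<^sub>i x\<^sub>i \<partial>\<^sub>i\<close>.\<close>

lemma der_eqI_nabla_const:
  fixes \<theta> \<eta> :: "('k::field_char_0, 'n::finite) der"
  assumes "\<And>i. homogeneous_poly k (\<theta> $ i)" "\<And>i. homogeneous_poly k (\<eta> $ i)" "k > 0"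
    and "\<And>v. nabla (const_der v) \<theta> = nabla (const_der v) \<eta>"
  shows "\<theta> = \<eta>"
proof -
  define E :: "('k, 'n) der" where "E = (\<chi> i. mvar i)"
  have E: "nabla E \<xi> = of_nat k *s \<xi>" if "\<And>i. homogeneous_poly k (\<xi> $ i)" for \<xi>
    by (simp add: vec_eq_iff nabla_nth der_apply_def E_def euler[OF that])
  have "nabla E \<theta> = nabla E \<eta>"
    by (subst (1 2) nabla_expand) (simp add: assms(4))
  then have eq: "of_nat k * (\<theta> $ i) = of_nat k * (\<eta> $ i)" for i
    using assms(1,2) by (simp add: E vec_eq_iff)
  show ?thesis
    unfolding vec_eq_iff
  proof
    fix i
    show "\<theta> $ i = \<eta> $ i"
      using arg_cong[OF eq[of i], of "(*) (mconst (inverse (of_nat k)))"] \<open>k > 0\<close>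
        mconst_cancel[of "of_nat k" "\<theta> $ i"] mconst_cancel[of "of_nat k" "\<eta> $ i"] by (simp add: mconst_of_nat)
  qed
qed

section \<open>Endomorphisms preserving an irreducible arrangement\<close>

lemma subspace_sum_commute: "subspace_sum U W = subspace_sum W U"
  unfolding subspace_sum_def by (metis (no_types, opaque_lifting) add.commute)

lemma dim_subspace_sum:
  assumes "vec.subspace U" "vec.subspace W" "U \<inter> W = {0}"
  shows "vec.dim (subspace_sum U W) = vec.dim U + vec.dim W"
  using vec.dim_sums_Int[OF assms(1,2)] assms(3) by (simp add: subspace_sum_def)

lemma subspace_sum_Int_eq:
  assumes "vec.subspace H" "W \<subseteq> H" "vec.subspace W" "subspace_sum U W = UNIV"
  shows "subspace_sum (H \<inter> U) W = H"
proof
  show "subspace_sum (H \<inter> U) W \<subseteq> H"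
    using assms(1,2) by (auto simp: subspace_sum_def intro: vec.subspace_add)
  show "H \<subseteq> subspace_sum (H \<inter> U) W"
  proof
    fix x assume x: "x \<in> H"
    from assms(4) have "x \<in> subspace_sum U W" by simp
    then obtain u w where uw: "x = u + w" "u \<in> U" "w \<in> W"
      by (auto simp: subspace_sum_def)
    have "x - w \<in> H"
      using x uw assms(1,2) by (intro vec.subspace_diff) auto
    with uw show "x \<in> subspace_sum (H \<inter> U) W"
      by (auto simp: subspace_sum_def)
  qed
qed

lemma hyperplane_in_Int:
  assumes "hyperplane_in UNIV H" "W \<subseteq> H" "vec.subspace U" "vec.subspace W"
    and "subspace_sum U W = UNIV" "U \<inter> W = {0}"
  shows "hyperplane_in U (H \<inter> U)"
proof -
  have H: "vec.subspace H" "vec.dim H + 1 = vec.dim (UNIV :: ('a^'b) set)"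
    using assms(1) by (simp_all add: hyperplane_in_def)
  have "H \<inter> U \<inter> W = {0}"
    using assms(6) H(1) vec.subspace_0 by auto
  then have "vec.dim H = vec.dim (H \<inter> U) + vec.dim W"
    using dim_subspace_sum[of "H \<inter> U" W] subspace_sum_Int_eq[OF H(1) assms(2,4,5)]
    by (simp add: vec.subspace_inter H(1) assms(3,4))
  moreover have "vec.dim (UNIV :: ('a^'b) set) = vec.dim U + vec.dim W"
    using dim_subspace_sum[OF assms(3,4,6)] assms(5) by simp
  ultimately show ?thesis
    using H by (simp add: hyperplane_in_def vec.subspace_inter assms(3))
qed

lemma defining_formsD:
  assumes "defining_forms A \<alpha>" "H \<in> A"
  shows "\<alpha> H \<in> dual_space" "\<alpha> H v = 0 \<longleftrightarrow> v \<in> H"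
  using assms by (auto simp: defining_forms_def)

lemma arrangement_hyperplane: "arrangement A \<Longrightarrow> H \<in> A \<Longrightarrow> hyperplane_in UNIV H"
  and arrangement_finite: "arrangement A \<Longrightarrow> finite A"
  by (simp_all add: arrangement_def arrangement_in_def)

lemma arrangement_forms_zero:
  assumes "arrangement A" "defining_forms A \<alpha>" "\<And>H. H \<in> A \<Longrightarrow> \<alpha> H v = 0"
  shows "v = 0"
proof -
  have "v \<in> \<Inter>A"
    using assms(2,3) by (auto simp: defining_formsD)
  with assms(1) show ?thesis by (simp add: arrangement_def)
qed

lemma hyperplane_neq_UNIV: "hyperplane_in UNIV H \<Longrightarrow> H \<noteq> UNIV"
  by (auto simp: hyperplane_in_def)

text \<open>
  Here every \<open>\<alpha> H\<close> is an eigenvector of the dual map of \<open>C\<close>, with eigenvalue \<open>l H\<close>. The common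
  zeros \<open>V2\<close> of the forms with eigenvalue \<open>l H0\<close> and the common zeros \<open>V1\<close> of the other forms
  give a product decomposition unless one of the two families is empty.
\<close>

lemma irreducible_same_eigenvalue:
  fixes A :: "('k::field_char_0^'n::finite) set set"
  assumes A: "arrangement A" "irreducible_arrangement A" and \<alpha>: "defining_forms A \<alpha>"
    and C: "Vector_Spaces.linear (*s) (*s) C"
    and eig: "\<And>H v. H \<in> A \<Longrightarrow> \<alpha> H (C v) = l H * \<alpha> H v"
    and HK: "H0 \<in> A" "K0 \<in> A"
  shows "l H0 = l K0"
proof (rule ccontr)
  assume neq: "l H0 \<noteq> l K0"
  define V1 where "V1 = {v. \<forall>K\<in>A. l K \<noteq> l H0 \<longrightarrow> \<alpha> K v = 0}"
  define V2 where "V2 = {v. \<forall>K\<in>A. l K = l H0 \<longrightarrow> \<alpha> K v = 0}"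
  define T where "T v = C v - l H0 *s v" for v
  interpret C: Vector_Spaces.linear "(*s)" "(*s)" C by fact
  have T: "Vector_Spaces.linear (*s) (*s) T"
    by unfold_locales (simp_all add: T_def C.add C.scale algebra_simps vec.scale_right_diff_distrib)
  interpret T: Vector_Spaces.linear "(*s)" "(*s)" T by fact
  have dual: "\<alpha> K \<in> dual_space" if "K \<in> A" for K
    using defining_formsD(1)[OF \<alpha> that] .
  have eigT: "\<alpha> K (T v) = (l K - l H0) * \<alpha> K v" if "K \<in> A" for K v
    using that by (simp add: T_def eig dual_spaceD[OF dual[OF that]] algebra_simps)
  have sub: "vec.subspace V1" "vec.subspace V2"
    by (auto simp: V1_def V2_def vec.subspace_def dual_spaceD dual)
  have inter: "V1 \<inter> V2 = {0}"
  proof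
    show "V1 \<inter> V2 \<subseteq> {0}"
      using arrangement_forms_zero[OF A(1) \<alpha>] by (auto simp: V1_def V2_def)
  qed (use sub vec.subspace_0 in auto)
  \<comment> \<open>\<open>V2\<close> contains the image of \<open>T = C - l H0\<close> and \<open>V1\<close> its kernel, so \<open>T\<close> restricts to a
    bijection of \<open>V2\<close>, and \<open>v\<close> differs from the preimage of \<open>T v\<close> in \<open>V2\<close> by an element of \<open>V1\<close>.\<close>
  have T_V2: "T v \<in> V2" for v
    by (simp add: V2_def eigT)
  have ker_V1: "v \<in> V1" if "T v = 0" for v
    unfolding V1_def
  proof (intro CollectI ballI impI)
    fix K assume "K \<in> A" "l K \<noteq> l H0"
    then show "\<alpha> K v = 0"
      using eigT[of K v] that dual_spaceD(3)[OF dual] by simp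
  qed
  have "inj_on T V2"
    unfolding T.inj_on_iff_eq_0[OF sub(2)] using ker_V1 inter by blast
  then have "vec.dim (T ` V2) = vec.dim V2"
    using sub(2) by (intro vec.dim_image_eq[OF T]) (simp add: vec.span_eq_iff[THEN iffD2])
  then have onto: "T ` V2 = V2"
    using T_V2 sub(2) by (intro vec.subspace_dim_equal T.subspace_image) auto
  have sum: "subspace_sum V1 V2 = UNIV"
  proof -
    have "v \<in> subspace_sum V1 V2" for v
    proof -
      obtain w where w: "w \<in> V2" "T v = T w"
        using onto T_V2[of v] by auto
      then have "v - w \<in> V1"
        by (intro ker_V1) (simp add: T.diff)
      moreover have "v = (v - w) + w" by simp
      ultimately show ?thesis
        using w(1) unfolding subspace_sum_def by blast
    qed
    then show ?thesis by auto
  qed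
  have proper: "K \<noteq> UNIV" if "K \<in> A" for K
    using hyperplane_neq_UNIV[OF arrangement_hyperplane[OF A(1) that]] .
  have V2_sub: "V2 \<subseteq> K" if "K \<in> A" "l K = l H0" for K
    using that defining_formsD(2)[OF \<alpha>] by (auto simp: V2_def)
  have V1_sub: "V1 \<subseteq> K" if "K \<in> A" "l K \<noteq> l H0" for K
    using that defining_formsD(2)[OF \<alpha>] by (auto simp: V1_def)
  have sum': "subspace_sum V2 V1 = UNIV" and inter': "V2 \<inter> V1 = {0}"
    using sum inter by (auto simp: subspace_sum_commute)
  have V1_nz: "V1 \<noteq> {0}"
  proof
    assume "V1 = {0}"
    then have "V2 = UNIV" using sum by (auto simp: subspace_sum_def)
    then show False using V2_sub[OF HK(1)] proper[OF HK(1)] by auto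
  qed
  have V2_nz: "V2 \<noteq> {0}"
  proof
    assume "V2 = {0}"
    then have "V1 = UNIV" using sum by (auto simp: subspace_sum_def)
    then show False using V1_sub[OF HK(2)] proper[OF HK(2)] neq by auto
  qed
  define A1 where "A1 = (\<lambda>K. K \<inter> V1) ` {K \<in> A. l K = l H0}"
  define A2 where "A2 = (\<lambda>K. K \<inter> V2) ` {K \<in> A. l K \<noteq> l H0}"
  have A1: "arrangement_in V1 A1"
    using A(1) V2_sub sub sum inter
    by (auto simp: arrangement_in_def A1_def arrangement_finite arrangement_hyperplane
        intro!: hyperplane_in_Int[where W = V2])
  have A2: "arrangement_in V2 A2"
    using A(1) V1_sub sub sum' inter'
    by (auto simp: arrangement_in_def A2_def arrangement_finite arrangement_hyperplane
        intro!: hyperplane_in_Int[where W = V1])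
  have A_eq: "A = {subspace_sum H V2 | H. H \<in> A1} \<union> {subspace_sum V1 H | H. H \<in> A2}"
  proof -
    have subK: "vec.subspace K" if "K \<in> A" for K
      using arrangement_hyperplane[OF A(1) that] by (simp add: hyperplane_in_def)
    have 1: "subspace_sum (K \<inter> V1) V2 = K" if "K \<in> A" "l K = l H0" for K
      using subspace_sum_Int_eq[OF subK[OF that(1)] V2_sub[OF that] sub(2) sum] .
    have 2: "subspace_sum V1 (K \<inter> V2) = K" if "K \<in> A" "l K \<noteq> l H0" for K
      using subspace_sum_Int_eq[OF subK[OF that(1)] V1_sub[OF that] sub(1) sum']
      by (simp add: subspace_sum_commute)
    have "{subspace_sum H V2 | H. H \<in> A1} = (\<lambda>K. subspace_sum (K \<inter> V1) V2) ` {K \<in> A. l K = l H0}"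
      "{subspace_sum V1 H | H. H \<in> A2} = (\<lambda>K. subspace_sum V1 (K \<inter> V2)) ` {K \<in> A. l K \<noteq> l H0}"
      by (auto simp: A1_def A2_def)
    moreover have "\<dots> = {K \<in> A. l K \<noteq> l H0}"
      using 2 by (auto simp: image_iff)
    moreover have "(\<lambda>K. subspace_sum (K \<inter> V1) V2) ` {K \<in> A. l K = l H0} = {K \<in> A. l K = l H0}"
      using 1 by (auto simp: image_iff)
    ultimately show ?thesis by auto
  qed
  from A(2) show False
    unfolding irreducible_arrangement_def
    by (rule notE)
      (rule exI[of _ V1], rule exI[of _ V2], rule exI[of _ A1], rule exI[of _ A2],
        intro conjI sub V1_nz V2_nz inter sum A1 A2 A_eq)
qed

lemma irreducible_endomorphism_scalar:
  fixes A :: "('k::field_char_0^'n::finite) set set"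
  assumes A: "arrangement A" "irreducible_arrangement A" and \<alpha>: "defining_forms A \<alpha>"
    and C: "Vector_Spaces.linear (*s) (*s) C"
    and inv: "\<And>H v. H \<in> A \<Longrightarrow> v \<in> H \<Longrightarrow> C v \<in> H"
  shows "\<exists>c. \<forall>v. C v = c *s v"
proof -
  interpret C: Vector_Spaces.linear "(*s)" "(*s)" C by fact
  \<comment> \<open>\<open>\<alpha> H \<circ> C\<close> vanishes on the kernel of \<open>\<alpha> H\<close>, hence is a multiple of it.\<close>
  have "\<exists>l. \<forall>v. \<alpha> H (C v) = l * \<alpha> H v" if H: "H \<in> A" for H
  proof -
    note a = defining_formsD[OF \<alpha> H]
    obtain w where w: "\<alpha> H w \<noteq> 0"
      using a(2) hyperplane_neq_UNIV[OF arrangement_hyperplane[OF A(1) H]] by auto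
    have "\<alpha> H (C v) = \<alpha> H (C w) / \<alpha> H w * \<alpha> H v" for v
    proof -
      have "C (v - (\<alpha> H v / \<alpha> H w) *s w) \<in> H"
        using w by (intro inv H) (simp add: dual_spaceD[OF a(1)] flip: a(2))
      then have "\<alpha> H (C v - (\<alpha> H v / \<alpha> H w) *s C w) = 0"
        by (simp add: a(2) C.diff C.scale)
      then show ?thesis by (simp add: dual_spaceD[OF a(1)])
    qed
    then show ?thesis by blast
  qed
  then obtain l where l: "\<And>H v. H \<in> A \<Longrightarrow> \<alpha> H (C v) = l H * \<alpha> H v"
    by metis
  have "A \<noteq> {}"
  proof
    assume "A = {}"
    then have "(UNIV :: ('k^'n) set) = {0}"
      using A(1) by (simp add: arrangement_def)
    then have "(1 :: 'k^'n) = 0" by blast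
    then show False by simp
  qed
  then obtain H0 where H0: "H0 \<in> A" by blast
  have "C v = l H0 *s v" for v
  proof -
    have "C v - l H0 *s v = 0"
    proof (rule arrangement_forms_zero[OF A(1) \<alpha>])
      fix H assume H: "H \<in> A"
      have "l H = l H0"
        by (rule irreducible_same_eigenvalue[OF A \<alpha> C l H H0])
      then show "\<alpha> H (C v - l H0 *s v) = 0"
        using l[OF H, of v] by (simp add: dual_spaceD[OF defining_formsD(1)[OF \<alpha> H]])
    qed
    then show ?thesis by simp
  qed
  then show ?thesis by blast
qed

section \<open>Modules of logarithmic derivations\<close>

lemma log_derD:
  "\<theta> \<in> log_der A \<alpha> m \<Longrightarrow> H \<in> A \<Longrightarrow>
    lin_poly (\<alpha> H) ^ m H dvd der_apply \<theta> (lin_poly (\<alpha> H))"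
  by (simp add: log_der_def)

lemma log_der_mono:
  assumes "\<And>H. H \<in> A \<Longrightarrow> m H \<le> m' H"
  shows "log_der A \<alpha> m' \<subseteq> log_der A \<alpha> m"
proof
  fix \<theta> assume "\<theta> \<in> log_der A \<alpha> m'"
  then show "\<theta> \<in> log_der A \<alpha> m"
    unfolding log_der_def by (auto intro: dvd_trans[OF le_imp_power_dvd[OF assms]])
qed

lemma subspace_log_der: "der.subspace (log_der A \<alpha> m)"
  by (auto simp: der.subspace_def log_der_def der_apply_add_left der_apply_scale_left
      der_apply_def[of 0])

lemma nabla_in_log_der:
  assumes "\<theta> \<in> log_der A \<alpha> (mult_plus_one m)"
  shows "nabla \<phi> \<theta> \<in> log_der A \<alpha> m"
  unfolding log_der_def
proof (intro CollectI ballI)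
  fix H assume H: "H \<in> A"
  let ?L = "lin_poly (\<alpha> H)"
  from log_derD[OF assms H] obtain h where "der_apply \<theta> ?L = ?L ^ Suc (m H) * h"
    by (auto simp: mult_plus_one_def)
  then have "der_apply (nabla \<phi> \<theta>) ?L =
      ?L ^ m H * (of_nat (Suc (m H)) * der_apply \<phi> ?L * h + ?L * der_apply \<phi> h)"
    by (simp add: der_apply_nabla_lin_poly der_apply_mult der_apply_power algebra_simps
        del: power_Suc of_nat_Suc) (simp add: algebra_simps)
  then show "?L ^ m H dvd der_apply (nabla \<phi> \<theta>) ?L" by simp
qed

lemma log_der_degD:
  assumes "\<eta> \<in> log_der_deg A \<alpha> m k"
  shows "\<eta> \<in> log_der A \<alpha> m" "homogeneous_poly k (\<eta> $ i)"
  using assms by (auto simp: log_der_deg_def homogeneous_der_iff)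

lemma log_der_degI:
  assumes "\<eta> \<in> log_der A \<alpha> m" "\<And>i. homogeneous_poly k (\<eta> $ i)"
  shows "\<eta> \<in> log_der_deg A \<alpha> m k"
  using assms by (auto simp: log_der_deg_def homogeneous_der_iff)

lemma zero_in_log_der_deg: "0 \<in> log_der_deg A \<alpha> m k"
  using der.subspace_0[OF subspace_log_der] by (intro log_der_degI) auto

lemma log_der_below_eq_0:
  assumes "\<And>j \<eta>. j < k \<Longrightarrow> \<eta> \<in> log_der_deg A \<alpha> m j \<Longrightarrow> \<eta> = 0"
  shows "log_der_below A \<alpha> m k = {0}"
proof
  show "log_der_below A \<alpha> m k \<subseteq> {0}"
    unfolding log_der_below_def using assms by (auto intro!: sum.neutral)
  have "(\<Sum>j<k. 0) \<in> log_der_below A \<alpha> m k"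
    unfolding log_der_below_def using zero_in_log_der_deg by blast
  then show "{0} \<subseteq> log_der_below A \<alpha> m k" by simp
qed

text \<open>
  A homogeneous combination of elements of degree \<open>d\<close> vanishes if its degree is less than \<open>d\<close>; if its
  degree is \<open>d\<close>, the coefficients may be replaced by their constant terms.
\<close>

lemma homogeneous_combination:
  fixes \<eta> :: "('k::field_char_0, 'n::finite) der" and b :: "'j \<Rightarrow> ('k, 'n) der"
  assumes \<eta>: "\<eta> = (\<Sum>j\<in>J. u j *s b j)"
    and "\<And>i. homogeneous_poly k (\<eta> $ i)"
    and b: "\<And>j i. j \<in> J \<Longrightarrow> homogeneous_poly d (b j $ i)"
    and "k \<le> d"
  shows "\<eta> = (if k = d then \<Sum>j\<in>J. mconst (Poly_Mapping.lookup (u j) 0) *s b j else 0)"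
  unfolding vec_eq_iff
proof
  fix i
  have "\<eta> $ i = hom_part k (\<eta> $ i)"
    using hom_part_homogeneous[OF assms(2)[of i], of k] by simp
  also have "\<dots> = (\<Sum>j\<in>J. hom_part k (u j * b j $ i))"
    by (simp add: \<eta> sum_component hom_part_sum)
  also have "\<dots> = (\<Sum>j\<in>J. if k = d then hom_part 0 (u j) * b j $ i else 0)"
    using \<open>k \<le> d\<close> by (intro sum.cong) (auto simp: hom_part_mult_homogeneous[OF b])
  finally show "\<eta> $ i =
      (if k = d then \<Sum>j\<in>J. mconst (Poly_Mapping.lookup (u j) 0) *s b j else 0) $ i"
    by (simp add: sum_component hom_part_zero_const)
qed

lemma log_der_const_zero:
  assumes A: "arrangement A" "defining_forms A \<alpha>"
    and c: "const_der c \<in> log_der A \<alpha> (mult_plus_one m)"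
  shows "c = 0"
proof (rule arrangement_forms_zero[OF A])
  fix H assume H: "H \<in> A"
  have "lin_poly (\<alpha> H) dvd lin_poly (\<alpha> H) ^ (m H + 1)"
    by simp
  also have "\<dots> dvd mconst (\<alpha> H c)"
    using log_derD[OF c H] A H
    by (simp add: mult_plus_one_def der_apply_const_der_lin_poly defining_formsD)
  finally show "\<alpha> H c = 0" by (rule lin_poly_not_dvd_const)
qed

lemma arrangement_form_nonzero:
  assumes "arrangement A" "defining_forms A \<alpha>" "H \<in> A"
  obtains w where "\<alpha> H w \<noteq> 0"
  using defining_formsD(2)[OF assms(2,3)] hyperplane_neq_UNIV[OF arrangement_hyperplane[OF assms(1,3)]]
  by auto

lemma arrangement_hyperplane_not_subset:
  assumes "arrangement A" "H \<in> A" "K \<in> A" "H \<noteq> K"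
  obtains u where "u \<in> K" "u \<notin> H"
proof -
  have "hyperplane_in UNIV H" "hyperplane_in UNIV K"
    using assms arrangement_hyperplane by blast+
  then have "\<not> K \<subseteq> H"
    using assms(4) vec.subspace_dim_equal[of K H] by (auto simp: hyperplane_in_def)
  then show thesis using that by blast
qed

text \<open>
  With \<open>Q = \<Prod>\<^sub>H L\<^sub>H\<^sup>m\<^sup>(\<^sup>H\<^sup>)\<close> and \<open>\<alpha>\<^sub>K(w) \<noteq> 0\<close>, the derivation \<open>Q \<partial>\<^sub>w\<close> lies in \<open>D(A, m)\<close>, and its value
  at \<open>L\<^sub>K\<close>, a nonzero scalar multiple of \<open>Q\<close>, is divisible by \<open>L\<^sub>K\<close> exactly \<open>m(K)\<close> times.
\<close>

lemma log_der_not_subset_delta: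
  assumes A: "arrangement A" and \<alpha>: "defining_forms A \<alpha>" and K: "K \<in> A"
  shows "\<not> log_der A \<alpha> m \<subseteq> log_der A \<alpha> (mult_plus_delta m K)"
proof
  assume sub: "log_der A \<alpha> m \<subseteq> log_der A \<alpha> (mult_plus_delta m K)"
  define Q where "Q = (\<Prod>H\<in>A. lin_poly (\<alpha> H) ^ m H)"
  define Q' where "Q' = (\<Prod>H\<in>A - {K}. lin_poly (\<alpha> H) ^ m H)"
  let ?L = "lin_poly (\<alpha> K)"
  note K' = defining_formsD[OF \<alpha> K]
  obtain w where w: "\<alpha> K w \<noteq> 0"
    using arrangement_form_nonzero[OF A \<alpha> K] .
  have "Q *s const_der w \<in> log_der A \<alpha> m"
    unfolding log_der_def
  proof (intro CollectI ballI)
    fix H assume "H \<in> A"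
    then have "lin_poly (\<alpha> H) ^ m H dvd Q"
      unfolding Q_def using A by (intro dvd_prodI) (auto simp: arrangement_finite)
    then show "lin_poly (\<alpha> H) ^ m H dvd der_apply (Q *s const_der w) (lin_poly (\<alpha> H))"
      by (simp add: der_apply_scale_left)
  qed
  with sub have "Q *s const_der w \<in> log_der A \<alpha> (mult_plus_delta m K)" ..
  from log_derD[OF this K] have "?L ^ Suc (m K) dvd der_apply (Q *s const_der w) ?L"
    by (simp add: mult_plus_delta_def)
  also have "der_apply (Q *s const_der w) ?L = ?L ^ m K * (Q' * mconst (\<alpha> K w))"
    using A K by (simp add: der_apply_scale_left der_apply_const_der_lin_poly K' Q_def Q'_def
        prod.remove[of A K] arrangement_finite mult.assoc)
  finally have "?L dvd Q' * mconst (\<alpha> K w)"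
    by (rule lin_poly_power_Suc_dvd_cancel[OF K'(1) w])
  then have "?L dvd (\<Prod>H\<in>A - {K}. lin_poly (\<alpha> H) ^ m H) * mconst (\<alpha> K w)"
    by (simp only: Q'_def)
  moreover have "\<alpha> H \<in> dual_space \<and> (\<exists>u. \<alpha> K u = 0 \<and> \<alpha> H u \<noteq> 0)" if H: "H \<in> A - {K}" for H
  proof -
    from H obtain u where "u \<in> K" "u \<notin> H"
      using arrangement_hyperplane_not_subset[OF A, of H K] K by auto
    with H show ?thesis
      using defining_formsD[OF \<alpha>, of H] K'(2) by auto
  qed
  ultimately have "?L dvd mconst (\<alpha> K w)"
    using A K'(1)
    by (intro lin_poly_dvd_prod_mult[of "A - {K}" "\<alpha> K" \<alpha> m "mconst (\<alpha> K w)"])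
      (simp_all add: arrangement_finite)
  with w show False by (blast dest: lin_poly_not_dvd_const)
qed

lemma log_der_delta_if_dvd_nabla:
  assumes \<alpha>: "defining_forms A \<alpha>" and \<theta>: "\<theta> \<in> log_der A \<alpha> (mult_plus_one m)"
    and H: "H \<in> A" "\<alpha> H v \<noteq> 0"
    and dvd: "lin_poly (\<alpha> H) ^ Suc (m H) dvd
      der_apply (nabla (const_der v) \<theta>) (lin_poly (\<alpha> H))"
  shows "\<theta> \<in> log_der A \<alpha> (mult_plus_delta (mult_plus_one m) H)"
proof -
  let ?L = "lin_poly (\<alpha> H)"
  from log_derD[OF \<theta> H(1)] obtain h where h: "der_apply \<theta> ?L = ?L ^ Suc (m H) * h"
    by (auto simp: mult_plus_one_def)
  have "?L dvd h"
    using dvd unfolding der_apply_nabla_lin_poly h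
    by (rule lin_poly_dvd_if_dvd_derivative[OF defining_formsD(1)[OF \<alpha> H(1)] H(2)])
  then have "?L ^ Suc (m H) * ?L dvd der_apply \<theta> ?L"
    unfolding h by (rule mult_dvd_mono[OF dvd_refl])
  with \<theta> show ?thesis
    by (auto simp: log_der_def mult_plus_delta_def mult_plus_one_def mult.commute)
qed

lemma nabla_right_scale_const: "nabla \<phi> (mconst c *s \<theta>) = mconst c *s nabla \<phi> \<theta>"
  by (simp add: vec_eq_iff nabla_nth der_apply_mult)

lemma nabla_right_zero [simp]: "nabla \<phi> 0 = 0"
  by (simp add: vec_eq_iff nabla_nth)

section \<open>Universal derivations\<close>

lemma universal_imp_critical:
  fixes A :: "('k::field_char_0^'n::finite) set set"
  assumes A: "arrangement A" "irreducible_arrangement A" and \<alpha>: "defining_forms A \<alpha>"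
    and \<theta>: "\<theta> \<in> log_der A \<alpha> (mult_plus_one m)" and hom: "homogeneous_der (d + 1) \<theta>"
    and bij: "bij_betw (\<lambda>\<phi>. nabla \<phi> \<theta>) UNIV (log_der A \<alpha> m)"
  shows "critical A \<alpha> (mult_plus_one m) (d + 1)"
proof -
  have hom\<theta>: "homogeneous_poly (d + 1) (\<theta> $ i)" for i
    using hom by (simp add: homogeneous_der_iff)
  have inj: "\<phi> = \<psi>" if "nabla \<phi> \<theta> = nabla \<psi> \<theta>" for \<phi> \<psi>
    using bij that by (auto simp: bij_betw_def dest: injD)
  \<comment> \<open>\<open>D(A, m)\<close> vanishes below degree \<open>d\<close> and consists of the \<open>\<nabla>\<^sub>c \<theta>\<close>, \<open>c\<close> constant, in degree \<open>d\<close>.\<close>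
  have low: "\<exists>c. \<eta> = (if k = d then nabla (const_der c) \<theta> else 0)"
    if \<eta>: "\<eta> \<in> log_der A \<alpha> m" "\<And>i. homogeneous_poly k (\<eta> $ i)" and k: "k \<le> d" for \<eta> k
  proof -
    obtain \<phi> where \<phi>: "\<eta> = nabla \<phi> \<theta>"
      using bij \<eta>(1) by (auto simp: bij_betw_def)
    define c where "c = (\<chi> i. Poly_Mapping.lookup (\<phi> $ i) 0)"
    have "\<eta> = (if k = d then \<Sum>i\<in>UNIV. mconst (Poly_Mapping.lookup (\<phi> $ i) 0) *s
        nabla (const_der (axis i 1)) \<theta> else 0)"
      by (rule homogeneous_combination[OF \<phi>[unfolded nabla_expand[of \<phi>]] \<eta>(2) _ k])
        (rule homogeneous_nabla_const[OF hom\<theta>])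
    also have "(\<Sum>i\<in>UNIV. mconst (Poly_Mapping.lookup (\<phi> $ i) 0) *s nabla (const_der (axis i 1)) \<theta>) =
        nabla (const_der c) \<theta>"
      by (subst nabla_expand[of "const_der c"]) (simp add: c_def)
    finally show ?thesis by blast
  qed
  have below: "\<eta> = 0" if \<eta>: "\<eta> \<in> log_der_deg A \<alpha> (mult_plus_one m) k" and k: "k < d + 1" for \<eta> k
  proof -
    note hom\<eta> = log_der_degD(2)[OF \<eta>] and log = log_der_degD(1)[OF \<eta>]
    show ?thesis
    proof (cases k)
      case 0
      define c where "c = (\<chi> i. Poly_Mapping.lookup (\<eta> $ i) 0)"
      have "\<eta> = const_der c"
        using hom_part_homogeneous[OF hom\<eta>, where k = 0] 0
        by (simp add: vec_eq_iff c_def hom_part_zero_const)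
      with log have "const_der c \<in> log_der A \<alpha> (mult_plus_one m)" by simp
      then have "c = 0" by (rule log_der_const_zero[OF A(1) \<alpha>])
      with \<open>\<eta> = const_der c\<close> show ?thesis by (simp add: vec_eq_iff)
    next
      case (Suc j)
      have "nabla (const_der v) \<eta> = nabla (const_der v) 0" for v
        using low[OF nabla_in_log_der[OF log] homogeneous_nabla_const, of j] hom\<eta> Suc k by auto
      then show ?thesis
        using hom\<eta> Suc by (intro der_eqI_nabla_const[of k \<eta> 0]) auto
    qed
  qed
  have \<theta>_notin: "\<theta> \<notin> log_der A \<alpha> (mult_plus_delta (mult_plus_one m) K)" if K: "K \<in> A" for K
  proof
    assume *: "\<theta> \<in> log_der A \<alpha> (mult_plus_delta (mult_plus_one m) K)"
    also have "mult_plus_delta (mult_plus_one m) K = mult_plus_one (mult_plus_delta m K)"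
      by (auto simp: mult_plus_delta_def mult_plus_one_def)
    finally have "range (\<lambda>\<phi>. nabla \<phi> \<theta>) \<subseteq> log_der A \<alpha> (mult_plus_delta m K)"
      using nabla_in_log_der by blast
    then have "log_der A \<alpha> m \<subseteq> log_der A \<alpha> (mult_plus_delta m K)"
      using bij by (simp add: bij_betw_def)
    with log_der_not_subset_delta[OF A(1) \<alpha> K] show False by blast
  qed
  have crit: "\<eta> = 0"
    if H: "H \<in> A" and \<eta>: "\<eta> \<in> log_der_deg A \<alpha> (mult_plus_delta (mult_plus_one m) H) (d + 1)"
    for H \<eta>
  proof -
    note hom\<eta> = log_der_degD(2)[OF \<eta>]
    have log: "\<eta> \<in> log_der A \<alpha> (mult_plus_one m)"
      using log_der_degD(1)[OF \<eta>]
        log_der_mono[of A "mult_plus_one m" "mult_plus_delta (mult_plus_one m) H" \<alpha>]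
      by (auto simp: mult_plus_delta_def)
    have "\<exists>w. nabla (const_der v) \<eta> = nabla (const_der w) \<theta>" for v
      using low[OF nabla_in_log_der[OF log] homogeneous_nabla_const[OF hom\<eta>]] by auto
    then obtain C where C: "\<And>v. nabla (const_der v) \<eta> = nabla (const_der (C v)) \<theta>"
      by metis
    have C_add: "C (v + w) = C v + C w" for v w
    proof -
      have "nabla (const_der (C (v + w))) \<theta> = nabla (const_der (C v + C w)) \<theta>"
        by (simp add: const_der_add nabla_add flip: C)
      from inj[OF this] show ?thesis by simp
    qed
    have C_scale: "C (a *s v) = a *s C v" for a v
    proof -
      have "nabla (const_der (C (a *s v))) \<theta> = nabla (const_der (a *s C v)) \<theta>"
        by (simp add: const_der_scale nabla_scale flip: C)
      from inj[OF this] show ?thesis by simp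
    qed
    have lin: "Vector_Spaces.linear (*s) (*s) C"
      by unfold_locales (simp_all add: C_add C_scale)
    have inv: "C v \<in> K" if K: "K \<in> A" and v: "v \<in> K" for K v
    proof (rule ccontr)
      assume "C v \<notin> K"
      let ?L = "lin_poly (\<alpha> K)"
      note a = defining_formsD[OF \<alpha> K]
      obtain g where g: "der_apply \<eta> ?L = ?L ^ Suc (m K) * g"
        using log_derD[OF log K] by (auto simp: mult_plus_one_def)
      have "der_apply (nabla (const_der v) \<eta>) ?L = ?L ^ Suc (m K) * der_apply (const_der v) g"
        using v a(2)[of v] by (simp add: der_apply_nabla_lin_poly g der_apply_mult
            der_apply_power der_apply_const_der_lin_poly[OF a(1)] del: power_Suc)
      then have "?L ^ Suc (m K) dvd der_apply (nabla (const_der (C v)) \<theta>) ?L"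
        by (simp add: C del: power_Suc)
      then have "\<theta> \<in> log_der A \<alpha> (mult_plus_delta (mult_plus_one m) K)"
        using \<open>C v \<notin> K\<close> a(2) by (intro log_der_delta_if_dvd_nabla[OF \<alpha> \<theta> K]) auto
      with \<theta>_notin[OF K] show False ..
    qed
    obtain c where c: "\<And>v. C v = c *s v"
      using irreducible_endomorphism_scalar[OF A \<alpha> lin inv] by blast
    have eq: "\<eta> = mconst c *s \<theta>"
    proof (rule der_eqI_nabla_const[where k = "d + 1"])
      show "nabla (const_der v) \<eta> = nabla (const_der v) (mconst c *s \<theta>)" for v
        by (simp add: C c const_der_scale nabla_scale nabla_right_scale_const)
    qed (use hom\<eta> hom\<theta> in \<open>auto intro: homogeneous_poly_mconst_mult\<close>)
    have "c = 0"
    proof (rule ccontr)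
      assume "c \<noteq> 0"
      then have "\<theta> \<in> log_der A \<alpha> (mult_plus_delta (mult_plus_one m) H)"
        using log_der_degD(1)[OF \<eta>] unfolding log_der_def eq
        by (auto simp: der_apply_scale_left intro: mconst_dvd_cancel)
      with \<theta>_notin[OF H] show False ..
    qed
    with eq show ?thesis by simp
  qed
  have "\<theta> \<in> log_der_deg A \<alpha> (mult_plus_one m) (d + 1)" "\<theta> \<noteq> 0"
    using \<theta> hom by (simp_all add: log_der_deg_def homogeneous_der_iff)
  then show ?thesis
    unfolding critical_def
    using log_der_below_eq_0[of "d + 1" A \<alpha> "mult_plus_one m"] below crit zero_in_log_der_deg
    by blast
qed

lemma universal_imp_exponents:
  fixes \<theta> :: "('k::field_char_0, 'n::finite) der"
  assumes hom: "homogeneous_der (d + 1) \<theta>"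
    and bij: "bij_betw (\<lambda>\<phi>. nabla \<phi> \<theta>) UNIV (log_der A \<alpha> m)"
  shows "has_exponents A \<alpha> m (replicate CARD('n) d)"
proof -
  define b where "b i = nabla (const_der (axis i 1)) \<theta>" for i :: 'n
  have inj: "\<phi> = \<psi>" if "nabla \<phi> \<theta> = nabla \<psi> \<theta>" for \<phi> \<psi>
    using bij that by (auto simp: bij_betw_def dest: injD)
  have inj_b: "inj b"
  proof (rule injI)
    fix i j assume "b i = b j"
    then have "axis i 1 = (axis j 1 :: 'k^'n)"
      using inj[of "const_der (axis i 1)" "const_der (axis j 1)"] by (simp add: b_def)
    then show "i = j" by (simp add: axis_eq_axis)
  qed
  have comb: "(\<Sum>x\<in>range b. u x *s x) = nabla (\<chi> i. u (b i)) \<theta>" for u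
    by (simp add: sum.reindex[OF inj_b] nabla_expand[of "\<chi> i. u (b i)"] flip: b_def)
  have "der.independent (range b)"
  proof -
    have "u (b i) = 0" if "(\<Sum>x\<in>range b. u x *s x) = 0" for u i
    proof -
      have "nabla (\<chi> i. u (b i)) \<theta> = nabla 0 \<theta>"
        using that by (simp add: comb)
      from inj[OF this] show ?thesis by (simp add: vec_eq_iff)
    qed
    then show ?thesis
      by (subst der.dependent_finite) auto
  qed
  moreover have "der.span (range b) = log_der A \<alpha> m"
  proof -
    have "der.span (range b) = range (\<lambda>u. nabla (\<chi> i. u (b i)) \<theta>)"
      by (simp add: der.span_finite comb)
    also have "\<dots> = range (\<lambda>\<phi>. nabla \<phi> \<theta>)"
    proof -
      have "nabla \<phi> \<theta> \<in> range (\<lambda>u. nabla (\<chi> i. u (b i)) \<theta>)" for \<phi>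
        using inv_f_f[OF inj_b] by (intro image_eqI[of _ _ "\<lambda>x. \<phi> $ inv b x"]) simp_all
      then show ?thesis by auto
    qed
    also have "\<dots> = log_der A \<alpha> m"
      using bij by (simp add: bij_betw_def)
    finally show ?thesis .
  qed
  ultimately have basis: "der_basis (log_der A \<alpha> m) (range b)"
    by (simp add: der_basis_def)
  have hom_b: "homogeneous_der d (b i)" for i
  proof -
    have "b i \<noteq> 0"
    proof
      assume "b i = 0"
      then have "const_der (axis i 1) = (0 :: ('k, 'n) der)"
        using inj[of "const_der (axis i 1)" 0] by (simp add: b_def)
      then show False by (auto simp: vec_eq_iff axis_def dest: spec[of _ i])
    qed
    then show ?thesis
      using hom by (simp add: homogeneous_der_iff b_def homogeneous_nabla_const)
  qed
  obtain xs :: "'n list" where xs: "set xs = UNIV" "distinct xs"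
    using finite_distinct_list[of "UNIV :: 'n set"] by auto
  show ?thesis
    unfolding has_exponents_def
  proof (intro exI conjI)
    show "distinct (map b xs)"
      using xs inj_b by (simp add: distinct_map)
    show "der_basis (log_der A \<alpha> m) (set (map b xs))"
      using basis xs by simp
    show "list_all2 homogeneous_der (replicate CARD('n) d) (map b xs)"
      using xs hom_b distinct_card[of xs] by (simp add: list_all2_conv_all_nth)
  qed
qed

lemma exponents_critical_imp_universal:
  fixes A :: "('k::field_char_0^'n::finite) set set"
  assumes A: "arrangement A" and \<alpha>: "defining_forms A \<alpha>"
    and \<theta>: "\<theta> \<in> log_der A \<alpha> (mult_plus_one m)" and hom: "homogeneous_der (d + 1) \<theta>"
    and exps: "has_exponents A \<alpha> m (replicate CARD('n) d)"
    and crit: "critical A \<alpha> (mult_plus_one m) (d + 1)"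
  shows "bij_betw (\<lambda>\<phi>. nabla \<phi> \<theta>) UNIV (log_der A \<alpha> m)"
proof -
  have hom\<theta>: "homogeneous_poly (d + 1) (\<theta> $ i)" for i
    using hom by (simp add: homogeneous_der_iff)
  have nondeg: "v = 0" if "nabla (const_der v) \<theta> = 0" for v
  proof (rule arrangement_forms_zero[OF A \<alpha>], rule ccontr)
    fix H assume H: "H \<in> A" "\<alpha> H v \<noteq> 0"
    have "\<theta> \<in> log_der A \<alpha> (mult_plus_delta (mult_plus_one m) H)"
      by (rule log_der_delta_if_dvd_nabla[OF \<alpha> \<theta> H]) (simp add: that der_apply_def[of 0])
    with crit H(1) hom show False
      unfolding critical_def log_der_deg_def homogeneous_der_def by blast
  qed
  obtain bs where bs: "distinct bs" "der_basis (log_der A \<alpha> m) (set bs)"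
    "list_all2 homogeneous_der (replicate CARD('n) d) bs"
    using exps unfolding has_exponents_def by blast
  have "card (set bs) = CARD('n)"
    using bs by (simp add: distinct_card list_all2_lengthD flip: list_all2_lengthD[OF bs(3)])
  then obtain b :: "'n \<Rightarrow> ('k, 'n) der" where b: "bij_betw b UNIV (set bs)"
    using finite_same_card_bij[of "UNIV :: 'n set" "set bs"] by auto
  have inj_b: "inj b" and range_b: "range b = set bs"
    using b by (auto simp: bij_betw_def)
  have hom_b: "homogeneous_poly d (b j $ i)" for i j
  proof -
    have "b j \<in> set bs" using range_b by auto
    then show ?thesis
      using bs(3) by (auto simp: list_all2_conv_all_nth in_set_conv_nth homogeneous_der_iff)
  qed
  have comb: "(\<Sum>x\<in>range b. u x *s x) = (\<Sum>i\<in>UNIV. u (b i) *s b i)" for u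
    by (simp add: sum.reindex[OF inj_b])
  have span: "\<exists>q. \<eta> = (\<Sum>i\<in>UNIV. q i *s b i)" if "\<eta> \<in> log_der A \<alpha> m" for \<eta>
  proof -
    have "\<eta> \<in> der.span (range b)"
      using that bs(2) by (simp add: der_basis_def range_b)
    then show ?thesis by (auto simp: der.span_finite comb)
  qed
  have indep: "q i = 0" if "(\<Sum>i\<in>UNIV. q i *s b i) = 0" for q i
  proof (rule ccontr)
    assume "q i \<noteq> 0"
    moreover have "(\<Sum>x\<in>range b. q (inv b x) *s x) = 0"
      using that by (simp add: comb inv_f_f[OF inj_b])
    ultimately have "der.dependent (range b)"
      by (subst der.dependent_finite)
        (auto intro!: exI[of _ "\<lambda>x. q (inv b x)"] simp: inv_f_f[OF inj_b])
    with bs(2) show False by (simp add: der_basis_def range_b)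
  qed
  have "\<exists>r. nabla (const_der (axis j 1)) \<theta> = (\<Sum>i\<in>UNIV. mconst (r i) *s b i)" for j
  proof -
    obtain q where q: "nabla (const_der (axis j 1)) \<theta> = (\<Sum>i\<in>UNIV. q i *s b i)"
      using span[OF nabla_in_log_der[OF \<theta>]] by blast
    show ?thesis
      using homogeneous_combination[OF q homogeneous_nabla_const[OF hom\<theta>] hom_b] by auto
  qed
  then obtain r where r: "\<And>j. nabla (const_der (axis j 1)) \<theta> = (\<Sum>i\<in>UNIV. mconst (r j i) *s b i)"
    by metis
  \<comment> \<open>The column \<open>j\<close> of \<open>M\<close> holds the coordinates of \<open>\<nabla>\<^sub>\<partial>\<^sub>j \<theta>\<close> with respect to the basis \<open>b\<close>.\<close>
  define M :: "'k^'n^'n" where "M = (\<chi> i j. r j i)"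
  have nabla_b: "nabla \<phi> \<theta> = (\<Sum>i\<in>UNIV. (\<Sum>j\<in>UNIV. mconst (M $ i $ j) * \<phi> $ j) *s b i)" for \<phi>
  proof -
    have "nabla \<phi> \<theta> = (\<Sum>j\<in>UNIV. \<Sum>i\<in>UNIV. (mconst (M $ i $ j) * \<phi> $ j) *s b i)"
      by (subst nabla_expand)
        (simp add: r M_def der.scale_sum_right mult.commute)
    also have "\<dots> = (\<Sum>i\<in>UNIV. \<Sum>j\<in>UNIV. (mconst (M $ i $ j) * \<phi> $ j) *s b i)"
      by (rule sum.swap)
    finally show ?thesis by (simp add: der.scale_sum_left)
  qed
  have "v = 0" if "M *v v = 0" for v
  proof (rule nondeg)
    have "(\<Sum>j\<in>UNIV. mconst (M $ i $ j) * const_der v $ j) = mconst ((M *v v) $ i)" for i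
      by (simp add: matrix_vector_mult_def mconst_sum mconst_mult)
    with that show "nabla (const_der v) \<theta> = 0"
      by (simp add: nabla_b)
  qed
  then obtain N where N: "N ** M = mat 1"
    using matrix_left_invertible_ker[of M] by blast
  then have N': "M ** N = mat 1"
    by (simp add: matrix_left_right_inverse)
  \<comment> \<open>Mutually inverse constant matrices also act inversely on vectors of polynomials.\<close>
  have act: "(\<Sum>j\<in>UNIV. mconst (P $ i $ j) * (\<Sum>l\<in>UNIV. mconst (R $ j $ l) * q l)) = q i"
    if "P ** R = mat 1" for P R :: "'k^'n^'n" and q :: "'n \<Rightarrow> ('k, 'n) mpol" and i
  proof -
    have "(\<Sum>j\<in>UNIV. mconst (P $ i $ j) * (\<Sum>l\<in>UNIV. mconst (R $ j $ l) * q l)) =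
        (\<Sum>l\<in>UNIV. \<Sum>j\<in>UNIV. mconst (P $ i $ j * R $ j $ l) * q l)"
      by (subst sum.swap) (simp add: sum_distrib_left mconst_mult mult.assoc)
    also have "\<dots> = (\<Sum>l\<in>UNIV. mconst ((P ** R) $ i $ l) * q l)"
      by (simp add: matrix_matrix_mult_def mconst_sum sum_distrib_right)
    also have "\<dots> = (\<Sum>l\<in>UNIV. if l = i then q l else 0)"
      unfolding that by (intro sum.cong) (auto simp: mat_def)
    finally show ?thesis by simp
  qed
  show ?thesis
    unfolding bij_betw_def
  proof (intro conjI injI subset_antisym subsetI)
    fix \<phi> \<psi> assume "nabla \<phi> \<theta> = nabla \<psi> \<theta>"
    then have "nabla (\<phi> - \<psi>) \<theta> = 0" by (simp add: nabla_diff)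
    then have "(\<Sum>j\<in>UNIV. mconst (M $ i $ j) * (\<phi> - \<psi>) $ j) = 0" for i
      unfolding nabla_b by (rule indep)
    then have "(\<phi> - \<psi>) $ i = 0" for i
      using act[OF N, of i "\<lambda>j. (\<phi> - \<psi>) $ j"] by simp
    then show "\<phi> = \<psi>" by (simp add: vec_eq_iff)
  next
    fix \<eta> assume "\<eta> \<in> log_der A \<alpha> m"
    then obtain q where q: "\<eta> = (\<Sum>i\<in>UNIV. q i *s b i)"
      using span by blast
    have "\<eta> = nabla (\<chi> j. \<Sum>l\<in>UNIV. mconst (N $ j $ l) * q l) \<theta>"
      by (simp add: nabla_b act[OF N'] q)
    then show "\<eta> \<in> range (\<lambda>\<phi>. nabla \<phi> \<theta>)" by blast
  qed (use nabla_in_log_der[OF \<theta>] in auto)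
qed

theorem theorem1p2:
  fixes A :: "('k::field_char_0^'n::finite) set set"
    and \<alpha> :: "('k^'n) set \<Rightarrow> 'k^'n \<Rightarrow> 'k"
    and m :: "('k^'n) set \<Rightarrow> nat"
    and \<theta> :: "('k, 'n) der"
    and d :: nat
  assumes "arrangement A"
    and "irreducible_arrangement A"
    and "defining_forms A \<alpha>"
    and "\<theta> \<in> log_der A \<alpha> (mult_plus_one m)"
    and "homogeneous_der (d + 1) \<theta>"
  shows "universal_der A \<alpha> m \<theta> \<longleftrightarrow>
    free_mult A \<alpha> m \<and> has_exponents A \<alpha> m (replicate CARD('n) d) \<and>
    critical A \<alpha> (mult_plus_one m) (d + 1)"
proof -
  have "universal_der A \<alpha> m \<theta> \<longleftrightarrow> bij_betw (\<lambda>\<phi>. nabla \<phi> \<theta>) UNIV (log_der A \<alpha> m)"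
    using assms(4,5) module_hom_nabla unfolding universal_der_def by blast
  moreover have "free_mult A \<alpha> m" if "has_exponents A \<alpha> m es" for es
    using that unfolding has_exponents_def free_mult_def by blast
  ultimately show ?thesis
    using universal_imp_exponents[OF assms(5)] universal_imp_critical[OF assms]
      exponents_critical_imp_universal[OF assms(1,3,4,5)]
    by blast
qed

end
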